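(* For each $i\in\{1,2\}$ consider an SLTI-PHS (i) of dimensions $d(i)$ (state) and $n(i)$ (control), with $N(i)=0$ in the definition of SLTI-PHS, and assume that its control set $\mathcal{A}(i)$ is the set of all $\mathbb{R}^{n(i)}$-valued progressively measurable processes $u$ with $\mathbb{E}[\int_0^t\|u_s\|^2ds]<\infty$ for all $t\in\mathbb{R}_+$. Let $\hat n\in\{1,\dots,\min\{n(1),n(2)\}\}$ and let $K\in\mathbb{R}^{2\hat n\times2\hat n}$ satisfy $K=-K^\top$. Then the interconnected system (I) (i.e. the interconnection of the SLTI-PHS (1) and the SLTI-PHS (2) via $\binom{u^c(1)}{u^c(2)}=K\binom{Y^c(1)}{Y^c(2)}$) is an SLTI-PHS.
   Context: Both systems live on a common filtered probability space satisfying the usual conditions and are driven by the same $\mathbb{R}^k$-valued Wiener process $W=(W^1,\dots,W^k)$; $\mathbb{R}_+=[0,\infty)$. Definition (SLTI-PHS). A system $dX_t=b(X_t,u_t)dt+\sum_{j=1}^k\sigma^j(X_t,u_t)dW^j_t$, $Y_t=f(X_t,u_t)$, $X_0=x_0\in\mathbb{R}^d$, $u\in\mathcal{A}$, with $d$-dimensional state and $n$-dimensional control and output, is a stochastic, linear, time-invariant port-Hamiltonian system (SLTI-PHS) if there exist $J,R,Q,\overline{\mathfrak{A}}(j)\in\mathbb{R}^{d\times d}$, $F,P,\mathfrak{B}(j)\in\mathbb{R}^{d\times n}$ ($j=1,\dots,k$), $S,N\in\mathbb{R}^{n\times n}$ such that $J=-J^\top$, $R=R^\top$, $Q=Q^\top\ge0$,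 $S=S^\top$, $N=-N^\top$, $$\begin{pmatrix} R & P \\ P^\top & S \end{pmatrix}\ge0,$$ and for all $x\in\mathbb{R}^d$, $v\in\mathbb{R}^n$, $i\in\{1,\dots,k\}$ $$b(x,v)=\Big(J-R-\tfrac12\sum_{j=1}^k\overline{\mathfrak{A}}^\top(j)Q\overline{\mathfrak{A}}(j)\Big)Qx+(F-P)v,\qquad \sigma^i(x,v)=\overline{\mathfrak{A}}(i)Qx+\mathfrak{B}(i)v,$$ $$f(x,v)=\Big(F+P+\sum_{j=1}^k\overline{\mathfrak{A}}^\top(j)Q\mathfrak{B}(j)\Big)^\top Qx+\Big(S+N+\tfrac12\sum_{j=1}^k\mathfrak{B}^\top(j)Q\mathfrak{B}(j)\Big)v.$$ Such a system is linear: $b(x,v)=Ax+Bv$, $\sigma^j(x,v)=\mathfrak{A}(j)x+\mathfrak{B}(j)v$, $f(x,v)=Cx+Dv$ with system matrices $A,B,\mathfrak{A}(j),\mathfrak{B}(j),C,D$. For the SLTI-PHS (i), $N(i)$ denotes the matrix $N$ in this definition. Interconnection. Let $A(i),B(i),(\mathfrak{A}(j,i))_j,(\mathfrak{B}(j,i))_j,C(i),D(i)$ be the system matrices of system (i), $i\in\{1,2\}$. Split each control as $u(i)=(u^c(i)^\top,u^e(i)^\top)^\top$ with $u^c(i)$ the first $\hat n$ components (used for connecting) and $u^e(i)$ the remaining $n(i)-\hat n$ components (external inputs); split the outputs $Y(i)=(Y^c(i)^\top,Y^e(i)^\top)^\top$ in the same way, and partition accordingly $B(i)=(B^c(i),B^e(i))$,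 $\mathfrak{B}(j,i)=(\mathfrak{B}^c(j,i),\mathfrak{B}^e(j,i))$, $$C(i)=\begin{pmatrix} C^c(i) \\ C^e(i) \end{pmatrix},\qquad D(i)=\begin{pmatrix} D^c(i) & D^{ce}(i) \\ D^{ec}(i) & D^e(i) \end{pmatrix}.$$ For a pair $G(1),G(2)$ of matrices write $G=\begin{pmatrix} G(1) & 0 \\ 0 & G(2) \end{pmatrix}$ (this defines $A,\mathfrak{A}(j),B^c,B^e,\mathfrak{B}^c(j),\mathfrak{B}^e(j),C^c,C^e,D^c,D^{ce},D^{ec},D^e$). Let $\mathfrak{D}:=\mathrm{Id}-KD^c$. If $\mathfrak{D}$ is invertible, the interconnection relation $\binom{u^c(1)}{u^c(2)}=K\binom{Y^c(1)}{Y^c(2)}$ yields the interconnected system (I), with state $X=(X(1)^\top,X(2)^\top)^\top$, input $u=(u^e(1)^\top,u^e(2)^\top)^\top$ and output $Y=(Y^e(1)^\top,Y^e(2)^\top)^\top$, given by $$dX_t=\big[(A+B^c\mathfrak{D}^{-1}KC^c)X_t+(B^c\mathfrak{D}^{-1}KD^{ce}+B^e)u_t\big]dt+\sum_{j=1}^k\big[(\mathfrak{A}(j)+\mathfrak{B}^c(j)\mathfrak{D}^{-1}KC^c)X_t+(\mathfrak{B}^c(j)\mathfrak{D}^{-1}KD^{ce}+\mathfrak{B}^e(j))u_t\big]dW_t^j,$$ $$Y_t=(C^e+D^{ec}\mathfrak{D}^{-1}KC^c)X_t+(D^{ec}\mathfrak{D}^{-1}KD^{ce}+D^e)u_t,\qquad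 X_0=x_0\in\mathbb{R}^{d(1)+d(2)},\quad u\in\mathcal{A},$$ where $\mathcal{A}$ is the set of all $\mathbb{R}^{n(1)+n(2)-2\hat n}$-valued progressively measurable $u$ with $\mathbb{E}[\int_0^t\|u_s\|^2ds]<\infty$ for all $t\in\mathbb{R}_+$. (If $n(1)=n(2)=\hat n$ the interconnected system has no input and no output.) *)

theory Defs
  imports "HOL-Probability.Probability" "Jordan_Normal_Form.Gauss_Jordan_Elimination"
begin

text \<open>
  Vectors and matrices are those of \<^theory>\<open>Jordan_Normal_Form.Matrix\<close>. Dimensions vary inside a
  single statement and may be zero (a system may have neither input nor output).
\<close>

unbundle no vec_syntax
no_notation inner (infix \<open>\<bullet>\<close> 70)


section \<open>Stochastic setting\<close>

text \<open>Only times \<open>t \<ge> 0\<close> and Wiener components \<open>1, \<dots>, noise_dim\<close> are meaningful.\<close>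

record 'w stoch_basis =
  prob_meas :: "'w measure"
  filt :: "real \<Rightarrow> 'w measure"
  noise_dim :: nat
  wiener :: "nat \<Rightarrow> real \<Rightarrow> 'w \<Rightarrow> real"

text \<open>
  The library's \<^locale>\<open>filtration\<close> is indexed by a whole type; \<open>max 0\<close> restricts it to \<open>t \<ge> 0\<close>.
\<close>

definition usual_conditions :: "'w stoch_basis \<Rightarrow> bool" where
  "usual_conditions \<B> \<longleftrightarrow>
     (let M = prob_meas \<B>; \<F> = filt \<B> in
       prob_space M \<and>
       filtration (space M) (\<lambda>t. \<F> (max 0 t)) \<and>
       (\<forall>t\<ge>0. sets (\<F> t) \<subseteq> sets M) \<and>
       (\<forall>Z\<in>null_sets M. \<forall>A\<subseteq>Z. A \<in> sets (\<F> 0)) \<and>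
       (\<forall>t\<ge>0. sets (\<F> t) = (\<Inter>s\<in>{t<..}. sets (\<F> s))))"

text \<open>
  In the independence clause index \<open>0\<close> stands for \<open>\<F> s\<close> and index \<open>j \<ge> 1\<close> for the sigma-algebra
  generated by the \<open>j\<close>-th increment. Mutual independence of this family says that the vector of
  increments has independent components and is independent of \<open>\<F> s\<close>.
\<close>

definition wiener_process :: "'w stoch_basis \<Rightarrow> bool" where
  "wiener_process \<B> \<longleftrightarrow>
     (let M = prob_meas \<B>; \<F> = filt \<B>; k = noise_dim \<B>; W = wiener \<B> in
       0 < k \<and>
       (\<forall>j\<in>{1..k}.
          (\<forall>t\<ge>0. W j t \<in> borel_measurable (\<F> t)) \<and>
          (AE \<omega> in M. W j 0 \<omega> = 0) \<and>
          (AE \<omega> in M. continuous_on {0..} (\<lambda>t. W j t \<omega>))) \<and>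
       (\<forall>s\<ge>0. \<forall>t>s.
          (\<forall>j\<in>{1..k}. distributed M lborel (\<lambda>\<omega>. W j t \<omega> - W j s \<omega>)
                          (\<lambda>x. ennreal (normal_density 0 (sqrt (t - s)) x))) \<and>
          prob_space.indep_sets M
            (\<lambda>j. if j = 0 then sets (\<F> s)
                 else sets (vimage_algebra (space M) (\<lambda>\<omega>. W j t \<omega> - W j s \<omega>) borel))
            {0..k}))"

definition stochastic_basis :: "'w stoch_basis \<Rightarrow> bool" where
  "stochastic_basis \<B> \<longleftrightarrow> usual_conditions \<B> \<and> wiener_process \<B>"

definition progressively_measurable ::
  "'w stoch_basis \<Rightarrow> nat \<Rightarrow> (real \<Rightarrow> 'w \<Rightarrow> real vec) \<Rightarrow> bool" where
  "progressively_measurable \<B> n u \<longleftrightarrow>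
     (\<forall>t\<ge>0. \<forall>\<omega>\<in>space (prob_meas \<B>). u t \<omega> \<in> carrier_vec n) \<and>
     (\<forall>t\<ge>0. \<forall>i<n. (\<lambda>(s, \<omega>). u s \<omega> $ i)
        \<in> borel_measurable (restrict_space borel {0..t} \<Otimes>\<^sub>M filt \<B> t))"

definition square_integrable_controls ::
  "'w stoch_basis \<Rightarrow> nat \<Rightarrow> (real \<Rightarrow> 'w \<Rightarrow> real vec) set" where
  "square_integrable_controls \<B> n =
     {u. progressively_measurable \<B> n u \<and>
         (\<forall>t\<ge>0. (\<integral>\<^sup>+\<omega>. (\<integral>\<^sup>+s\<in>{0..t}. ennreal (u s \<omega> \<bullet> u s \<omega>) \<partial>lborel) \<partial>prob_meas \<B>) < \<infinity>)}"


section \<open>Control systems\<close>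

text \<open>
  A record \<open>\<Sigma>\<close> stands for the system
  \<open>dX = drift \<Sigma> X u dt + (\<Sum>j. diffusion \<Sigma> j X u dW j)\<close>, \<open>Y = readout \<Sigma> X u\<close>, \<open>X 0 = init \<Sigma>\<close>,
  \<open>u \<in> controls \<Sigma>\<close>, driven by the Wiener process of the underlying basis. The coefficient functions
  are meaningful only on \<open>carrier_vec (state_dim \<Sigma>)\<close> and \<open>carrier_vec (control_dim \<Sigma>)\<close>;
  \<open>control_dim\<close> is also the dimension of the output.
\<close>

record 'w control_system =
  state_dim :: nat
  control_dim :: nat
  drift :: "real vec \<Rightarrow> real vec \<Rightarrow> real vec"
  diffusion :: "nat \<Rightarrow> real vec \<Rightarrow> real vec \<Rightarrow> real vec"
  readout :: "real vec \<Rightarrow> real vec \<Rightarrow> real vec"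
  init :: "real vec"
  controls :: "(real \<Rightarrow> 'w \<Rightarrow> real vec) set"

definition wf_control_system :: "'w stoch_basis \<Rightarrow> 'w control_system \<Rightarrow> bool" where
  "wf_control_system \<B> \<Sigma> \<longleftrightarrow>
     (let d = state_dim \<Sigma>; n = control_dim \<Sigma> in
       0 < d \<and>
       (\<forall>x\<in>carrier_vec d. \<forall>v\<in>carrier_vec n.
          drift \<Sigma> x v \<in> carrier_vec d \<and>
          (\<forall>j\<in>{1..noise_dim \<B>}. diffusion \<Sigma> j x v \<in> carrier_vec d) \<and>
          readout \<Sigma> x v \<in> carrier_vec n) \<and>
       init \<Sigma> \<in> carrier_vec d \<and>
       (\<forall>u\<in>controls \<Sigma>. progressively_measurable \<B> n u))"


section \<open>Stochastic linear time-invariant port-Hamiltonian systems\<close>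

definition psd_mat :: "nat \<Rightarrow> real mat \<Rightarrow> bool" where
  "psd_mat n M \<longleftrightarrow> M \<in> carrier_mat n n \<and> M = M\<^sup>T \<and> (\<forall>v\<in>carrier_vec n. 0 \<le> v \<bullet> (M *\<^sub>v v))"

text \<open>Matrices of unspecified dimension form no additive monoid, so the sum is taken entrywise.\<close>

definition sum_mats :: "nat \<Rightarrow> nat \<Rightarrow> nat \<Rightarrow> (nat \<Rightarrow> real mat) \<Rightarrow> real mat" where
  "sum_mats nr nc k G = mat nr nc (\<lambda>ij. \<Sum>j=1..k. G j $$ ij)"

definition has_phs_form ::
  "nat \<Rightarrow> 'w control_system \<Rightarrow> real mat \<Rightarrow> real mat \<Rightarrow> real mat \<Rightarrow> (nat \<Rightarrow> real mat) \<Rightarrow>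
   real mat \<Rightarrow> real mat \<Rightarrow> (nat \<Rightarrow> real mat) \<Rightarrow> real mat \<Rightarrow> real mat \<Rightarrow> bool" where
  "has_phs_form k \<Sigma> J R Q AA F P BB S N \<longleftrightarrow>
     (let d = state_dim \<Sigma>; n = control_dim \<Sigma> in
       J \<in> carrier_mat d d \<and> R \<in> carrier_mat d d \<and> Q \<in> carrier_mat d d \<and>
       (\<forall>j\<in>{1..k}. AA j \<in> carrier_mat d d) \<and>
       F \<in> carrier_mat d n \<and> P \<in> carrier_mat d n \<and>
       (\<forall>j\<in>{1..k}. BB j \<in> carrier_mat d n) \<and>
       S \<in> carrier_mat n n \<and> N \<in> carrier_mat n n \<and>
       J = - J\<^sup>T \<and> R = R\<^sup>T \<and> psd_mat d Q \<and> S = S\<^sup>T \<and> N = - N\<^sup>T \<and>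
       psd_mat (d + n) (four_block_mat R P P\<^sup>T S) \<and>
       (\<forall>x\<in>carrier_vec d. \<forall>v\<in>carrier_vec n.
          drift \<Sigma> x v =
            ((J - R - (1/2) \<cdot>\<^sub>m sum_mats d d k (\<lambda>j. (AA j)\<^sup>T * Q * AA j)) * Q) *\<^sub>v x
            + (F - P) *\<^sub>v v \<and>
          (\<forall>i\<in>{1..k}. diffusion \<Sigma> i x v = (AA i * Q) *\<^sub>v x + BB i *\<^sub>v v) \<and>
          readout \<Sigma> x v =
            ((F + P + sum_mats d n k (\<lambda>j. (AA j)\<^sup>T * Q * BB j))\<^sup>T * Q) *\<^sub>v x
            + (S + N + (1/2) \<cdot>\<^sub>m sum_mats n n k (\<lambda>j. (BB j)\<^sup>T * Q * BB j)) *\<^sub>v v))"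

definition slti_phs_with_N :: "'w stoch_basis \<Rightarrow> 'w control_system \<Rightarrow> real mat \<Rightarrow> bool" where
  "slti_phs_with_N \<B> \<Sigma> N \<longleftrightarrow>
     wf_control_system \<B> \<Sigma> \<and>
     (\<exists>J R Q AA F P BB S. has_phs_form (noise_dim \<B>) \<Sigma> J R Q AA F P BB S N)"

definition slti_phs :: "'w stoch_basis \<Rightarrow> 'w control_system \<Rightarrow> bool" where
  "slti_phs \<B> \<Sigma> \<longleftrightarrow> (\<exists>N. slti_phs_with_N \<B> \<Sigma> N)"


section \<open>Interconnection\<close>

record system_matrices =
  mat_A :: "real mat"
  mat_B :: "real mat"
  mat_AA :: "nat \<Rightarrow> real mat"
  mat_BB :: "nat \<Rightarrow> real mat"
  mat_C :: "real mat"
  mat_D :: "real mat"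

text \<open>
  The matrices are uniquely determined by a linear system, except for \<open>mat_AA j\<close> and \<open>mat_BB j\<close>
  with \<open>j\<close> outside \<open>{1..k}\<close>.
\<close>

definition has_system_matrices :: "nat \<Rightarrow> 'w control_system \<Rightarrow> system_matrices \<Rightarrow> bool" where
  "has_system_matrices k \<Sigma> L \<longleftrightarrow>
     (let d = state_dim \<Sigma>; n = control_dim \<Sigma> in
       mat_A L \<in> carrier_mat d d \<and> mat_B L \<in> carrier_mat d n \<and>
       (\<forall>j\<in>{1..k}. mat_AA L j \<in> carrier_mat d d \<and> mat_BB L j \<in> carrier_mat d n) \<and>
       mat_C L \<in> carrier_mat n d \<and> mat_D L \<in> carrier_mat n n \<and>
       (\<forall>x\<in>carrier_vec d. \<forall>v\<in>carrier_vec n.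
          drift \<Sigma> x v = mat_A L *\<^sub>v x + mat_B L *\<^sub>v v \<and>
          (\<forall>j\<in>{1..k}. diffusion \<Sigma> j x v = mat_AA L j *\<^sub>v x + mat_BB L j *\<^sub>v v) \<and>
          readout \<Sigma> x v = mat_C L *\<^sub>v x + mat_D L *\<^sub>v v))"

definition block_diag :: "real mat \<Rightarrow> real mat \<Rightarrow> real mat" where
  "block_diag G1 G2 = four_block_mat G1 (0\<^sub>m (dim_row G1) (dim_col G2))
                                     (0\<^sub>m (dim_row G2) (dim_col G1)) G2"

text \<open>The four blocks of a matrix split after row \<open>r\<close> and column \<open>c\<close>.\<close>

definition block_ul :: "nat \<Rightarrow> nat \<Rightarrow> real mat \<Rightarrow> real mat" where
  "block_ul r c M = (case split_block M r c of (M11, M12, M21, M22) \<Rightarrow> M11)"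

definition block_ur :: "nat \<Rightarrow> nat \<Rightarrow> real mat \<Rightarrow> real mat" where
  "block_ur r c M = (case split_block M r c of (M11, M12, M21, M22) \<Rightarrow> M12)"

definition block_ll :: "nat \<Rightarrow> nat \<Rightarrow> real mat \<Rightarrow> real mat" where
  "block_ll r c M = (case split_block M r c of (M11, M12, M21, M22) \<Rightarrow> M21)"

definition block_lr :: "nat \<Rightarrow> nat \<Rightarrow> real mat \<Rightarrow> real mat" where
  "block_lr r c M = (case split_block M r c of (M11, M12, M21, M22) \<Rightarrow> M22)"

definition left_cols :: "nat \<Rightarrow> real mat \<Rightarrow> real mat" where
  "left_cols c M = block_ul (dim_row M) c M"

definition right_cols :: "nat \<Rightarrow> real mat \<Rightarrow> real mat" where
  "right_cols c M = block_ur (dim_row M) c M"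

definition upper_rows :: "nat \<Rightarrow> real mat \<Rightarrow> real mat" where
  "upper_rows r M = block_ul r (dim_col M) M"

definition lower_rows :: "nat \<Rightarrow> real mat \<Rightarrow> real mat" where
  "lower_rows r M = block_ll r (dim_col M) M"

text \<open>The matrix \<open>Id - K D\<^sup>c\<close>, whose invertibility makes the interconnection well defined.\<close>

definition coupling_mat ::
  "nat \<Rightarrow> real mat \<Rightarrow> system_matrices \<Rightarrow> system_matrices \<Rightarrow> real mat" where
  "coupling_mat m K L1 L2 =
     1\<^sub>m (2 * m) - K * block_diag (block_ul m m (mat_D L1)) (block_ul m m (mat_D L2))"

text \<open>
  Here \<open>m\<close> is the number of connected components of each control. The definition is meaningful only
  if the coupling matrix is invertible; otherwise \<open>the (mat_inverse \<dots>)\<close> is unspecified.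
\<close>

definition interconnection_matrices ::
  "nat \<Rightarrow> real mat \<Rightarrow> system_matrices \<Rightarrow> system_matrices \<Rightarrow> system_matrices" where
  "interconnection_matrices m K L1 L2 =
     (let A = block_diag (mat_A L1) (mat_A L2);
          AA = (\<lambda>j. block_diag (mat_AA L1 j) (mat_AA L2 j));
          Bc = block_diag (left_cols m (mat_B L1)) (left_cols m (mat_B L2));
          Be = block_diag (right_cols m (mat_B L1)) (right_cols m (mat_B L2));
          BBc = (\<lambda>j. block_diag (left_cols m (mat_BB L1 j)) (left_cols m (mat_BB L2 j)));
          BBe = (\<lambda>j. block_diag (right_cols m (mat_BB L1 j)) (right_cols m (mat_BB L2 j)));
          Cc = block_diag (upper_rows m (mat_C L1)) (upper_rows m (mat_C L2));
          Ce = block_diag (lower_rows m (mat_C L1)) (lower_rows m (mat_C L2));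
          Dce = block_diag (block_ur m m (mat_D L1)) (block_ur m m (mat_D L2));
          Dec = block_diag (block_ll m m (mat_D L1)) (block_ll m m (mat_D L2));
          De = block_diag (block_lr m m (mat_D L1)) (block_lr m m (mat_D L2));
          Di = the (mat_inverse (coupling_mat m K L1 L2))
      in \<lparr> mat_A = A + Bc * Di * K * Cc,
           mat_B = Bc * Di * K * Dce + Be,
           mat_AA = (\<lambda>j. AA j + BBc j * Di * K * Cc),
           mat_BB = (\<lambda>j. BBc j * Di * K * Dce + BBe j),
           mat_C = Ce + Dec * Di * K * Cc,
           mat_D = Dec * Di * K * Dce + De \<rparr>)"

definition interconnected_system ::
  "'w stoch_basis \<Rightarrow> nat \<Rightarrow> real mat \<Rightarrow> system_matrices \<Rightarrow> system_matrices \<Rightarrow> real vec \<Rightarrow>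
   'w control_system" where
  "interconnected_system \<B> m K L1 L2 x0 =
     (let L = interconnection_matrices m K L1 L2;
          d = dim_row (mat_A L1) + dim_row (mat_A L2);
          n = (dim_col (mat_B L1) - m) + (dim_col (mat_B L2) - m)
      in \<lparr> state_dim = d,
           control_dim = n,
           drift = (\<lambda>x v. mat_A L *\<^sub>v x + mat_B L *\<^sub>v v),
           diffusion = (\<lambda>j x v. mat_AA L j *\<^sub>v x + mat_BB L j *\<^sub>v v),
           readout = (\<lambda>x v. mat_C L *\<^sub>v x + mat_D L *\<^sub>v v),
           init = x0,
           controls = square_integrable_controls \<B> n \<rparr>)"

end

theory Submission
  imports Defs "Jordan_Normal_Form.Determinant"
begin

text \<open>
  In the co-state \<open>z = Q x\<close> a linear system whose matrices \<open>A\<close>, \<open>\<AA>(j)\<close>, \<open>C\<close> factor through \<open>Q\<close> can be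
  brought into SLTI-PHS form iff it satisfies the dissipation inequality
  \<open>z \<bullet> drift + 1/2 * (\<Sum>j. \<sigma>(j) \<bullet> Q \<sigma>(j)) \<le> v \<bullet> y\<close> for all \<open>z\<close> and \<open>v\<close>: the matrices \<open>J\<close>, \<open>R\<close>, \<open>F\<close>, \<open>P\<close>,
  \<open>S\<close>, \<open>N\<close> are then obtained by splitting into symmetric and skew parts. Both properties are inherited
  by the interconnection with \<open>Q = diag(Q(1), Q(2))\<close>, because the connected ports contribute
  \<open>u\<^sup>c \<bullet> y\<^sup>c = K y\<^sup>c \<bullet> y\<^sup>c = 0\<close>. The hypothesis \<open>N(i) = 0\<close> makes \<open>D\<^sup>c\<close> symmetric positive semidefinite,
  and with \<open>K\<close> skew this forces \<open>Id - K D\<^sup>c\<close> to have trivial kernel.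
\<close>

section \<open>Bilinear forms and dissipation\<close>

text \<open>The matrix may be rectangular, with the row-side vector first: cross terms such as
  \<open>P\<close> pair a co-state with a control.\<close>

definition bform :: "real mat \<Rightarrow> real vec \<Rightarrow> real vec \<Rightarrow> real" where
  "bform M y x = y \<bullet> (M *\<^sub>v x)"

context
  fixes M N :: "real mat" and r c :: nat and x y :: "real vec"
  assumes M: "M \<in> carrier_mat r c" and N: "N \<in> carrier_mat r c"
    and x: "x \<in> carrier_vec c" and y: "y \<in> carrier_vec r"
begin

lemma bform_add: "bform (M + N) y x = bform M y x + bform N y x"
  using M N x y
  by (simp add: bform_def add_mult_distrib_mat_vec[of _ r c] scalar_prod_add_distrib[of _ r])

lemma bform_minus: "bform (M - N) y x = bform M y x - bform N y x"
  using M N x y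
  by (simp add: bform_def minus_mult_distrib_mat_vec[of _ r c] scalar_prod_minus_distrib[of _ r])

lemma bform_smult: "bform (a \<cdot>\<^sub>m M) y x = a * bform M y x"
proof -
  have "(a \<cdot>\<^sub>m M) *\<^sub>v x = a \<cdot>\<^sub>v (M *\<^sub>v x)"
    using M x by (auto simp: scalar_prod_def sum_distrib_left mult.assoc)
  then show ?thesis
    using M x y by (simp add: bform_def)
qed

lemma bform_transpose: "bform M\<^sup>T x y = bform M y x"
  using M x y transpose_vec_mult_scalar[of M r c x y] comm_scalar_prod[of x c "M\<^sup>T *\<^sub>v y"]
  by (simp add: bform_def)

end

text \<open>A scalar equals its own transpose, while transposing a skew matrix flips the sign. This
  removes \<open>J\<close> and \<open>N\<close> from the energy balance and makes the coupling
  through \<open>K\<close> lossless.\<close>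

lemma bform_skew:
  assumes "M \<in> carrier_mat p p" "M = - M\<^sup>T" "x \<in> carrier_vec p"
  shows "bform M x x = 0"
proof -
  have "bform M x x = bform (- M) x x"
    using bform_transpose[OF assms(1,1,3,3)] assms(2)
    by (metis transpose_uminus transpose_transpose uminus_uminus_mat)
  also have "\<dots> = - bform M x x"
    using assms by (simp add: bform_def)
  finally show ?thesis by simp
qed

lemma bform_mult:
  assumes "A \<in> carrier_mat p q" "B \<in> carrier_mat q r" "x \<in> carrier_vec r"
  shows "bform (A * B) y x = bform A y (B *\<^sub>v x)"
  using assms by (simp add: bform_def)

text \<open>The transposed factor moves to the left argument. In this way the correction terms of
  the port-Hamiltonian form become \<open>Q\<close>-products of diffusion vectors.\<close>

lemma bform_congruence:
  assumes "A \<in> carrier_mat d p" "Q \<in> carrier_mat d d" "B \<in> carrier_mat d q"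
    and "x \<in> carrier_vec q" "y \<in> carrier_vec p"
  shows "bform (A\<^sup>T * Q * B) y x = bform Q (A *\<^sub>v y) (B *\<^sub>v x)"
proof -
  have "bform (A\<^sup>T * Q * B) y x = bform A\<^sup>T y (Q *\<^sub>v (B *\<^sub>v x))"
    using assms by (simp add: bform_mult[of _ p d _ q] bform_mult[of _ p d _ d])
  also have "\<dots> = bform A (Q *\<^sub>v (B *\<^sub>v x)) y"
    using assms by (intro bform_transpose) auto
  also have "\<dots> = bform Q (A *\<^sub>v y) (B *\<^sub>v x)"
    using assms by (auto simp: bform_def intro!: comm_scalar_prod[of _ d])
  finally show ?thesis .
qed

lemma sum_mats_carrier [simp]: "sum_mats r c k G \<in> carrier_mat r c"
  by (simp add: sum_mats_def)

lemma bform_sum_mats: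
  assumes "\<And>j. j \<in> {1..k} \<Longrightarrow> G j \<in> carrier_mat r c"
    and "x \<in> carrier_vec c" "y \<in> carrier_vec r"
  shows "bform (sum_mats r c k G) y x = (\<Sum>j=1..k. bform (G j) y x)"
proof -
  have "(\<Sum>j=1..k. bform (G j) y x) = (\<Sum>j=1..k. \<Sum>a<r. \<Sum>b<c. y $ a * (G j $$ (a, b) * x $ b))"
  proof (intro sum.cong refl)
    fix j assume "j \<in> {1..k}"
    from assms(1)[OF this] show "bform (G j) y x = (\<Sum>a<r. \<Sum>b<c. y $ a * (G j $$ (a, b) * x $ b))"
      using assms(2,3) by (simp add: bform_def scalar_prod_def sum_distrib_left atLeast0LessThan)
  qed
  \<comment> \<open>The sum over \<open>j\<close> passes first the row index, then the column index;
    it must end up innermost because \<open>sum_mats\<close> adds entrywise.\<close>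
  also have "\<dots> = (\<Sum>a<r. \<Sum>b<c. \<Sum>j=1..k. y $ a * (G j $$ (a, b) * x $ b))"
    by (subst sum.swap, intro sum.cong refl sum.swap)
  also have "\<dots> = bform (sum_mats r c k G) y x"
    using assms
    by (simp add: bform_def sum_mats_def scalar_prod_def sum_distrib_left sum_distrib_right
        atLeast0LessThan)
  finally show ?thesis ..
qed

lemma bform_four_block:
  assumes "M \<in> carrier_mat p q" "P \<in> carrier_mat p s" "P' \<in> carrier_mat r q" "S \<in> carrier_mat r s"
    and "x \<in> carrier_vec q" "v \<in> carrier_vec s" "y \<in> carrier_vec p" "w \<in> carrier_vec r"
  shows "bform (four_block_mat M P P' S) (y @\<^sub>v w) (x @\<^sub>v v)
       = bform M y x + bform P y v + bform P' w x + bform S w v"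
proof -
  have "bform (four_block_mat M P P' S) (y @\<^sub>v w) (x @\<^sub>v v)
      = (y @\<^sub>v w) \<bullet> ((M *\<^sub>v x + P *\<^sub>v v) @\<^sub>v (P' *\<^sub>v x + S *\<^sub>v v))"
    using assms by (simp add: bform_def four_block_mat_mult_vec[of _ p q _ s _ r])
  also have "\<dots> = y \<bullet> (M *\<^sub>v x + P *\<^sub>v v) + w \<bullet> (P' *\<^sub>v x + S *\<^sub>v v)"
    using assms by (intro scalar_prod_append[of _ p _ r]) auto
  also have "\<dots> = bform M y x + bform P y v + bform P' w x + bform S w v"
    using assms by (simp add: bform_def scalar_prod_add_distrib[of _ p] scalar_prod_add_distrib[of _ r])
  finally show ?thesis .
qed

lemma psd_mat_bform:
  "psd_mat d Q \<longleftrightarrow> Q \<in> carrier_mat d d \<and> Q = Q\<^sup>T \<and> (\<forall>v\<in>carrier_vec d. 0 \<le> bform Q v v)"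
  by (simp add: psd_mat_def bform_def)

lemma bform_symmetric:
  assumes "Q \<in> carrier_mat d d" "Q = Q\<^sup>T" "x \<in> carrier_vec d" "y \<in> carrier_vec d"
  shows "bform Q x y = bform Q y x"
  using bform_transpose[OF assms(1) assms(1,3,4)] assms(2) by simp

lemma bform_add_both:
  assumes "Q \<in> carrier_mat d d" "Q = Q\<^sup>T" "x \<in> carrier_vec d" "y \<in> carrier_vec d"
  shows "bform Q (x + y) (x + y) = bform Q x x + 2 * bform Q x y + bform Q y y"
proof -
  have "bform Q (x + y) (x + y) = bform Q x x + bform Q x y + (bform Q y x + bform Q y y)"
    using assms
    by (simp add: bform_def mult_add_distrib_mat_vec[of _ d d] scalar_prod_add_distrib[of _ d]
        add_scalar_prod_distrib[of _ d])
  then show ?thesis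
    using bform_symmetric[OF assms] by simp
qed

text \<open>The dimension clauses of \<open>has_system_matrices\<close> without a control system
  attached, so that matrices acting on the co-state are covered as well.\<close>

definition system_carrier :: "nat \<Rightarrow> nat \<Rightarrow> nat \<Rightarrow> system_matrices \<Rightarrow> bool" where
  "system_carrier k d n L \<longleftrightarrow>
     mat_A L \<in> carrier_mat d d \<and> mat_B L \<in> carrier_mat d n \<and>
     (\<forall>j\<in>{1..k}. mat_AA L j \<in> carrier_mat d d \<and> mat_BB L j \<in> carrier_mat d n) \<and>
     mat_C L \<in> carrier_mat n d \<and> mat_D L \<in> carrier_mat n n"

text \<open>
  Dissipation inequality for the storage function \<open>x \<mapsto> (1/2) * (x \<bullet> (Q *\<^sub>v x))\<close>, written in the
  co-state \<open>z = Q *\<^sub>v x\<close>: here \<open>L\<close> acts on \<open>z\<close> rather than on \<open>x\<close>. It is demanded for all \<open>z\<close>, also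
  outside the range of \<open>Q\<close>, since the block matrix in the definition of an SLTI-PHS has to be
  positive semidefinite on the whole space.
\<close>

definition dissipative :: "nat \<Rightarrow> nat \<Rightarrow> nat \<Rightarrow> real mat \<Rightarrow> system_matrices \<Rightarrow> bool" where
  "dissipative k d n Q L \<longleftrightarrow>
     (\<forall>z\<in>carrier_vec d. \<forall>v\<in>carrier_vec n.
        z \<bullet> (mat_A L *\<^sub>v z + mat_B L *\<^sub>v v)
        + (1/2) * (\<Sum>j=1..k. bform Q (mat_AA L j *\<^sub>v z + mat_BB L j *\<^sub>v v)
                                    (mat_AA L j *\<^sub>v z + mat_BB L j *\<^sub>v v))
        \<le> v \<bullet> (mat_C L *\<^sub>v z + mat_D L *\<^sub>v v))"

text \<open>The prescribed coefficients with the right factor \<open>Q\<close> stripped from the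
  state matrices, hence acting on the co-state.\<close>

definition phs_matrices ::
  "nat \<Rightarrow> nat \<Rightarrow> nat \<Rightarrow> real mat \<Rightarrow> real mat \<Rightarrow> real mat \<Rightarrow> (nat \<Rightarrow> real mat) \<Rightarrow> real mat \<Rightarrow> real mat \<Rightarrow>
   (nat \<Rightarrow> real mat) \<Rightarrow> real mat \<Rightarrow> real mat \<Rightarrow> system_matrices" where
  "phs_matrices k d n J R Q AA F P BB S N =
     \<lparr> mat_A = J - R - (1/2) \<cdot>\<^sub>m sum_mats d d k (\<lambda>j. (AA j)\<^sup>T * Q * AA j),
       mat_B = F - P,
       mat_AA = AA,
       mat_BB = BB,
       mat_C = (F + P + sum_mats d n k (\<lambda>j. (AA j)\<^sup>T * Q * BB j))\<^sup>T,
       mat_D = S + N + (1/2) \<cdot>\<^sub>m sum_mats n n k (\<lambda>j. (BB j)\<^sup>T * Q * BB j) \<rparr>"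

text \<open>
  The slack in the dissipation inequality is the quadratic form of the block matrix from the
  definition of an SLTI-PHS, so positive semidefiniteness of that matrix is dissipativity.
\<close>

lemma dissipation_defect:
  fixes J R Q F P S N :: "real mat"
  assumes car: "J \<in> carrier_mat d d" "R \<in> carrier_mat d d" "F \<in> carrier_mat d n"
    "P \<in> carrier_mat d n" "S \<in> carrier_mat n n" "N \<in> carrier_mat n n"
    and J: "J = - J\<^sup>T" and N: "N = - N\<^sup>T"
    and Q: "Q \<in> carrier_mat d d" "Q = Q\<^sup>T"
    and AA: "\<And>j. j \<in> {1..k} \<Longrightarrow> AA j \<in> carrier_mat d d"
    and BB: "\<And>j. j \<in> {1..k} \<Longrightarrow> BB j \<in> carrier_mat d n"
    and z: "z \<in> carrier_vec d" and v: "v \<in> carrier_vec n"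
    and L: "L = phs_matrices k d n J R Q AA F P BB S N"
  shows "v \<bullet> (mat_C L *\<^sub>v z + mat_D L *\<^sub>v v) - z \<bullet> (mat_A L *\<^sub>v z + mat_B L *\<^sub>v v)
         - (1/2) * (\<Sum>j=1..k. bform Q (mat_AA L j *\<^sub>v z + mat_BB L j *\<^sub>v v)
                                     (mat_AA L j *\<^sub>v z + mat_BB L j *\<^sub>v v))
       = bform (four_block_mat R P P\<^sup>T S) (z @\<^sub>v v) (z @\<^sub>v v)"
proof -
  let ?sA = "sum_mats d d k (\<lambda>j. (AA j)\<^sup>T * Q * AA j)"
  let ?sM = "sum_mats d n k (\<lambda>j. (AA j)\<^sup>T * Q * BB j)"
  let ?sB = "sum_mats n n k (\<lambda>j. (BB j)\<^sup>T * Q * BB j)"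
  have sA: "bform ?sA z z = (\<Sum>j=1..k. bform Q (AA j *\<^sub>v z) (AA j *\<^sub>v z))"
    using AA Q z
    by (subst bform_sum_mats) (auto intro!: sum.cong bform_congruence[of _ d d] mult_carrier_mat[of _ d d])
  have sM: "bform ?sM z v = (\<Sum>j=1..k. bform Q (AA j *\<^sub>v z) (BB j *\<^sub>v v))"
    using AA BB Q z v
    by (subst bform_sum_mats) (auto intro!: sum.cong bform_congruence[of _ d d] mult_carrier_mat[of _ d d])
  have sB: "bform ?sB v v = (\<Sum>j=1..k. bform Q (BB j *\<^sub>v v) (BB j *\<^sub>v v))"
    using BB Q v
    by (subst bform_sum_mats) (auto intro!: sum.cong bform_congruence[of _ d n] mult_carrier_mat[of _ n d])
  \<comment> \<open>Expansion of the noise term: its pure squares are matched by the corrections in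
    \<open>mat_A L\<close> and \<open>mat_D L\<close>, its mixed terms by the one in
    \<open>mat_C L\<close>.\<close>
  have "(\<Sum>j=1..k. bform Q (AA j *\<^sub>v z + BB j *\<^sub>v v) (AA j *\<^sub>v z + BB j *\<^sub>v v))
      = (\<Sum>j=1..k. bform Q (AA j *\<^sub>v z) (AA j *\<^sub>v z) + 2 * bform Q (AA j *\<^sub>v z) (BB j *\<^sub>v v)
                   + bform Q (BB j *\<^sub>v v) (BB j *\<^sub>v v))"
    using Q AA[THEN mult_mat_vec_carrier, OF _ z] BB[THEN mult_mat_vec_carrier, OF _ v]
    by (intro sum.cong refl bform_add_both[of _ d]) auto
  also have "\<dots> = bform ?sA z z + 2 * bform ?sM z v + bform ?sB v v"
    by (simp add: sA sM sB sum.distrib sum_distrib_left)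
  finally have quad: "(\<Sum>j=1..k. bform Q (mat_AA L j *\<^sub>v z + mat_BB L j *\<^sub>v v)
                                     (mat_AA L j *\<^sub>v z + mat_BB L j *\<^sub>v v))
       = bform ?sA z z + 2 * bform ?sM z v + bform ?sB v v"
    by (simp add: L phs_matrices_def)
  have "mat_A L \<in> carrier_mat d d" "mat_B L \<in> carrier_mat d n"
    "mat_C L \<in> carrier_mat n d" "mat_D L \<in> carrier_mat n n"
    using car by (auto simp: L phs_matrices_def intro!: minus_carrier_mat)
  then have lin: "z \<bullet> (mat_A L *\<^sub>v z + mat_B L *\<^sub>v v) = bform (mat_A L) z z + bform (mat_B L) z v"
    "v \<bullet> (mat_C L *\<^sub>v z + mat_D L *\<^sub>v v) = bform (mat_C L) v z + bform (mat_D L) v v"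
    using z v by (simp_all add: bform_def scalar_prod_add_distrib[of _ d] scalar_prod_add_distrib[of _ n])
  \<comment> \<open>\<open>J\<close> and \<open>N\<close> vanish as skew matrices. The output
    contributes \<open>F + P\<close> and the drift \<open>F - P\<close>, so in the difference
    \<open>F\<close> cancels and \<open>P\<close> doubles, as in the block matrix.\<close>
  have bA: "bform (mat_A L) z z = - bform R z z - (1/2) * bform ?sA z z"
    using car z bform_skew[OF car(1) J z]
    by (simp add: L phs_matrices_def bform_minus[of _ d d] bform_smult[of _ d d] minus_carrier_mat)
  have bB: "bform (mat_B L) z v = bform F z v - bform P z v"
    using car z v by (simp add: L phs_matrices_def bform_minus[of _ d n])
  have bC: "bform (mat_C L) v z = bform F z v + bform P z v + bform ?sM z v"
    using car z v by (simp add: L phs_matrices_def bform_transpose[of _ d n] bform_add[of _ d n])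
  have bD: "bform (mat_D L) v v = bform S v v + (1/2) * bform ?sB v v"
    using car v bform_skew[OF car(6) N v]
    by (simp add: L phs_matrices_def bform_add[of _ n n] bform_smult[of _ n n])
  have "bform (four_block_mat R P P\<^sup>T S) (z @\<^sub>v v) (z @\<^sub>v v) = bform R z z + 2 * bform P z v + bform S v v"
    using car z v by (simp add: bform_four_block[of _ d d _ n _ n] bform_transpose[of _ d n])
  then show ?thesis
    unfolding quad lin bA bB bC bD by (simp add: field_simps)
qed

section \<open>Port-Hamiltonian form and the dissipation inequality\<close>

text \<open>For any \<open>Q\<close>, moving the correction sums to the other side leaves a purely
  algebraic splitting; semidefiniteness of the block matrix is a separate matter, decided by
  dissipativity.\<close>

lemma ex_phs_matrices:
  assumes "system_carrier k d n L"
  obtains J R F P S N where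
    "J \<in> carrier_mat d d" "R \<in> carrier_mat d d" "F \<in> carrier_mat d n"
    "P \<in> carrier_mat d n" "S \<in> carrier_mat n n" "N \<in> carrier_mat n n"
    "J = - J\<^sup>T" "R = R\<^sup>T" "S = S\<^sup>T" "N = - N\<^sup>T"
    "L = phs_matrices k d n J R Q (mat_AA L) F P (mat_BB L) S N"
proof -
  let ?sA = "sum_mats d d k (\<lambda>j. (mat_AA L j)\<^sup>T * Q * mat_AA L j)"
  let ?sM = "sum_mats d n k (\<lambda>j. (mat_AA L j)\<^sup>T * Q * mat_BB L j)"
  let ?sB = "sum_mats n n k (\<lambda>j. (mat_BB L j)\<^sup>T * Q * mat_BB L j)"
  \<comment> \<open>The prescribed form is solved for its unknowns: \<open>G\<close> must be
    \<open>J - R\<close>, \<open>H\<close> must be \<open>F + P\<close> and \<open>E\<close> must be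
    \<open>S + N\<close>. So \<open>J\<close> and \<open>- R\<close> are the skew and symmetric
    parts of \<open>G\<close>, \<open>S\<close> and \<open>N\<close> the symmetric and skew parts of
    \<open>E\<close>, and \<open>F\<close>, \<open>P\<close> half the sum and half the difference of
    \<open>H\<close> and \<open>mat_B L\<close>, which is \<open>F - P\<close>.\<close>
  define G where "G = mat_A L + (1/2) \<cdot>\<^sub>m ?sA"
  define H where "H = (mat_C L)\<^sup>T - ?sM"
  define E where "E = mat_D L - (1/2) \<cdot>\<^sub>m ?sB"
  have L: "mat_A L \<in> carrier_mat d d" "mat_B L \<in> carrier_mat d n"
    "mat_C L \<in> carrier_mat n d" "mat_D L \<in> carrier_mat n n"
    using assms by (auto simp: system_carrier_def)
  have s: "dim_row ?sA = d" "dim_col ?sA = d" "dim_row ?sM = d" "dim_col ?sM = n"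
    "dim_row ?sB = n" "dim_col ?sB = n"
    by (simp_all add: sum_mats_def)
  have car: "G \<in> carrier_mat d d" "H \<in> carrier_mat d n" "E \<in> carrier_mat n n"
    using L by (auto simp: G_def H_def E_def intro!: minus_carrier_mat)
  have A: "mat_A L = (1/2) \<cdot>\<^sub>m (G - G\<^sup>T) - (- (1/2)) \<cdot>\<^sub>m (G + G\<^sup>T) - (1/2) \<cdot>\<^sub>m ?sA"
    using L s by (intro eq_matI) (auto simp: G_def field_simps)
  have B: "mat_B L = (1/2) \<cdot>\<^sub>m (H + mat_B L) - (1/2) \<cdot>\<^sub>m (H - mat_B L)"
    using L car by (intro eq_matI) (auto simp: field_simps)
  have C: "mat_C L = ((1/2) \<cdot>\<^sub>m (H + mat_B L) + (1/2) \<cdot>\<^sub>m (H - mat_B L) + ?sM)\<^sup>T"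
    using L s by (intro eq_matI) (auto simp: H_def field_simps)
  have D: "mat_D L = (1/2) \<cdot>\<^sub>m (E + E\<^sup>T) + (1/2) \<cdot>\<^sub>m (E - E\<^sup>T) + (1/2) \<cdot>\<^sub>m ?sB"
    using L s by (intro eq_matI) (auto simp: E_def field_simps)
  show thesis
  proof (rule that)
    show "L = phs_matrices k d n ((1/2) \<cdot>\<^sub>m (G - G\<^sup>T)) ((- (1/2)) \<cdot>\<^sub>m (G + G\<^sup>T)) Q (mat_AA L)
        ((1/2) \<cdot>\<^sub>m (H + mat_B L)) ((1/2) \<cdot>\<^sub>m (H - mat_B L)) (mat_BB L)
        ((1/2) \<cdot>\<^sub>m (E + E\<^sup>T)) ((1/2) \<cdot>\<^sub>m (E - E\<^sup>T))"
      using A B C D by (simp add: phs_matrices_def)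
    show "(1/2) \<cdot>\<^sub>m (G - G\<^sup>T) = - ((1/2) \<cdot>\<^sub>m (G - G\<^sup>T))\<^sup>T" "(- (1/2)) \<cdot>\<^sub>m (G + G\<^sup>T) = ((- (1/2)) \<cdot>\<^sub>m (G + G\<^sup>T))\<^sup>T"
      using car(1) by (intro eq_matI; auto simp: field_simps)+
    show "(1/2) \<cdot>\<^sub>m (E - E\<^sup>T) = - ((1/2) \<cdot>\<^sub>m (E - E\<^sup>T))\<^sup>T" "(1/2) \<cdot>\<^sub>m (E + E\<^sup>T) = ((1/2) \<cdot>\<^sub>m (E + E\<^sup>T))\<^sup>T"
      using car(3) by (intro eq_matI; auto simp: field_simps)+
  qed (use car L in \<open>auto intro!: minus_carrier_mat\<close>)
qed

text \<open>Every argument of the block matrix is a pair of co-state and control, on which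
  \<open>dissipation_defect\<close> identifies its quadratic form with the slack of the inequality.
  Shape and symmetry come from \<open>ex_phs_matrices\<close>.\<close>

lemma has_phs_form_if_dissipative:
  assumes L: "system_carrier k (state_dim \<Sigma>) (control_dim \<Sigma>) L"
    and Q: "psd_mat (state_dim \<Sigma>) Q"
    and diss: "dissipative k (state_dim \<Sigma>) (control_dim \<Sigma>) Q L"
    and act: "\<And>x v. \<lbrakk>x \<in> carrier_vec (state_dim \<Sigma>); v \<in> carrier_vec (control_dim \<Sigma>)\<rbrakk> \<Longrightarrow>
      drift \<Sigma> x v = mat_A L *\<^sub>v (Q *\<^sub>v x) + mat_B L *\<^sub>v v \<and>
      (\<forall>j\<in>{1..k}. diffusion \<Sigma> j x v = mat_AA L j *\<^sub>v (Q *\<^sub>v x) + mat_BB L j *\<^sub>v v) \<and>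
      readout \<Sigma> x v = mat_C L *\<^sub>v (Q *\<^sub>v x) + mat_D L *\<^sub>v v"
  shows "\<exists>J R F P S N. has_phs_form k \<Sigma> J R Q (mat_AA L) F P (mat_BB L) S N"
proof -
  define d n where "d = state_dim \<Sigma>" and "n = control_dim \<Sigma>"
  note L = L[folded d_def n_def] and Q = Q[folded d_def] and diss = diss[folded d_def n_def]
    and act = act[folded d_def n_def]
  obtain J R F P S N where
    car: "J \<in> carrier_mat d d" "R \<in> carrier_mat d d" "F \<in> carrier_mat d n"
    "P \<in> carrier_mat d n" "S \<in> carrier_mat n n" "N \<in> carrier_mat n n" and
    sym: "J = - J\<^sup>T" "R = R\<^sup>T" "S = S\<^sup>T" "N = - N\<^sup>T" and
    eq: "L = phs_matrices k d n J R Q (mat_AA L) F P (mat_BB L) S N"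
    using ex_phs_matrices[OF L] .
  have Qc: "Q \<in> carrier_mat d d" "Q = Q\<^sup>T"
    using Q by (auto simp: psd_mat_bform)
  have AA: "\<And>j. j \<in> {1..k} \<Longrightarrow> mat_AA L j \<in> carrier_mat d d"
    and BB: "\<And>j. j \<in> {1..k} \<Longrightarrow> mat_BB L j \<in> carrier_mat d n"
    using L by (auto simp: system_carrier_def)
  let ?M = "four_block_mat R P P\<^sup>T S"
  have Mc: "?M \<in> carrier_mat (d + n) (d + n)"
    using car by auto
  have MT: "?M = ?M\<^sup>T"
    using car sym(2,3) by (subst transpose_four_block_mat[of _ d d _ n _ n]) auto
  have "0 \<le> bform ?M w w" if "w \<in> carrier_vec (d + n)" for w
  proof -
    define z v where "z = vec_first w d" and "v = vec_last w n"
    have zv: "z \<in> carrier_vec d" "v \<in> carrier_vec n" "w = z @\<^sub>v v"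
      using that by (auto simp: z_def v_def)
    show ?thesis
      using diss[unfolded dissipative_def, rule_format, OF zv(1,2)]
        dissipation_defect[OF car sym(1,4) Qc AA BB zv(1,2) eq] zv(3) by simp
  qed
  then have "psd_mat (d + n) ?M"
    unfolding psd_mat_bform using Mc MT by auto
  moreover have "drift \<Sigma> x v = (mat_A L * Q) *\<^sub>v x + mat_B L *\<^sub>v v \<and>
      (\<forall>j\<in>{1..k}. diffusion \<Sigma> j x v = (mat_AA L j * Q) *\<^sub>v x + mat_BB L j *\<^sub>v v) \<and>
      readout \<Sigma> x v = (mat_C L * Q) *\<^sub>v x + mat_D L *\<^sub>v v"
    if "x \<in> carrier_vec d" "v \<in> carrier_vec n" for x v
  proof -
    have assoc: "(M * Q) *\<^sub>v x = M *\<^sub>v (Q *\<^sub>v x)" if "M \<in> carrier_mat r d" for M r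
      using that Qc(1) \<open>x \<in> carrier_vec d\<close> by (rule assoc_mult_mat_vec)
    show ?thesis
      using act[OF that] L by (auto simp: system_carrier_def assoc[of _ d] assoc[of _ n])
  qed
  moreover have "mat_A L = J - R - (1/2) \<cdot>\<^sub>m sum_mats d d k (\<lambda>j. (mat_AA L j)\<^sup>T * Q * mat_AA L j)"
    "mat_B L = F - P"
    "mat_C L = (F + P + sum_mats d n k (\<lambda>j. (mat_AA L j)\<^sup>T * Q * mat_BB L j))\<^sup>T"
    "mat_D L = S + N + (1/2) \<cdot>\<^sub>m sum_mats n n k (\<lambda>j. (mat_BB L j)\<^sup>T * Q * mat_BB L j)"
    by (subst eq, simp add: phs_matrices_def)+
  ultimately have "has_phs_form k \<Sigma> J R Q (mat_AA L) F P (mat_BB L) S N"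
    using car sym Q Qc AA BB
    unfolding has_phs_form_def Let_def d_def[symmetric] n_def[symmetric] by simp
  then show ?thesis by blast
qed

text \<open>A unit vector in one argument and zero in the other read off the entries. This
  identifies given system matrices with those prescribed by the port-Hamiltonian form.\<close>

lemma action_unique:
  fixes A A' B B' :: "real mat"
  assumes car: "A \<in> carrier_mat r c" "A' \<in> carrier_mat r c" "B \<in> carrier_mat r e" "B' \<in> carrier_mat r e"
    and eq: "\<And>x v. \<lbrakk>x \<in> carrier_vec c; v \<in> carrier_vec e\<rbrakk> \<Longrightarrow> A *\<^sub>v x + B *\<^sub>v v = A' *\<^sub>v x + B' *\<^sub>v v"
  shows "A = A'" "B = B'"
proof -
  have ent: "M $$ (i, j) = (M *\<^sub>v unit_vec q j) $ i" if "M \<in> carrier_mat p q" "i < p" "j < q"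
    for M :: "real mat" and i j p q
    using that by simp
  have zero: "M *\<^sub>v 0\<^sub>v q = 0\<^sub>v p" if "M \<in> carrier_mat p q" for M :: "real mat" and p q
    using that by auto
  show "A = A'"
  proof (intro eq_matI)
    fix i j assume "i < dim_row A'" "j < dim_col A'"
    then show "A $$ (i, j) = A' $$ (i, j)"
      using eq[of "unit_vec c j" "0\<^sub>v e"] car
      by (simp add: zero[of _ r e] ent[of _ r c] del: index_mult_mat_vec)
  qed (use car in auto)
  show "B = B'"
  proof (intro eq_matI)
    fix i j assume "i < dim_row B'" "j < dim_col B'"
    then show "B $$ (i, j) = B' $$ (i, j)"
      using eq[of "0\<^sub>v c" "unit_vec e j"] car
      by (simp add: zero[of _ r c] ent[of _ r e] del: index_mult_mat_vec)
  qed (use car in auto)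
qed

lemma sum_mats_symmetric:
  assumes "\<And>j. j \<in> {1..k} \<Longrightarrow> G j \<in> carrier_mat n n" "\<And>j. j \<in> {1..k} \<Longrightarrow> (G j)\<^sup>T = G j"
  shows "(sum_mats n n k G)\<^sup>T = sum_mats n n k G"
proof -
  have "G j $$ (a, b) = G j $$ (b, a)" if "j \<in> {1..k}" "a < n" "b < n" for j a b
    using assms(1)[OF that(1)] that(2,3) arg_cong[OF assms(2)[OF that(1)], of "\<lambda>M. M $$ (a, b)"]
    by simp
  then show ?thesis
    by (intro eq_matI) (auto simp: sum_mats_def intro!: sum.cong)
qed

text \<open>\<open>L\<close> acts on the state \<open>x\<close>, \<open>L'\<close> on the co-state
  \<open>Q *\<^sub>v x\<close>. This is a relation because for singular \<open>Q\<close> the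
  matrices \<open>L'\<close> are not determined by \<open>L\<close>.\<close>

definition factors_through :: "nat \<Rightarrow> real mat \<Rightarrow> system_matrices \<Rightarrow> system_matrices \<Rightarrow> bool" where
  "factors_through k Q L L' \<longleftrightarrow>
     mat_A L = mat_A L' * Q \<and> mat_B L = mat_B L' \<and>
     (\<forall>j\<in>{1..k}. mat_AA L j = mat_AA L' j * Q \<and> mat_BB L j = mat_BB L' j) \<and>
     mat_C L = mat_C L' * Q \<and> mat_D L = mat_D L'"

text \<open>Nonnegativity of the block matrix, read through \<open>dissipation_defect\<close>, is
  the inequality. The symmetric feedthrough is where the zero \<open>N\<close> enters: what remains
  is \<open>S\<close> plus half a sum of congruences of the symmetric \<open>Q\<close>.\<close>

lemma phs_form_imp_dissipative:
  assumes phs: "has_phs_form k \<Sigma> J R Q AA F P BB S (0\<^sub>m (control_dim \<Sigma>) (control_dim \<Sigma>))"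
    and L: "has_system_matrices k \<Sigma> L"
  obtains L' where "system_carrier k (state_dim \<Sigma>) (control_dim \<Sigma>) L'"
    "dissipative k (state_dim \<Sigma>) (control_dim \<Sigma>) Q L'"
    "factors_through k Q L L'" "(mat_D L')\<^sup>T = mat_D L'"
proof -
  define d n where "d = state_dim \<Sigma>" and "n = control_dim \<Sigma>"
  note L = L[unfolded has_system_matrices_def Let_def, folded d_def n_def]
    and phs = phs[unfolded has_phs_form_def Let_def, folded d_def n_def]
  define L' where "L' = phs_matrices k d n J R Q AA F P BB S (0\<^sub>m n n)"
  have car: "J \<in> carrier_mat d d" "R \<in> carrier_mat d d" "F \<in> carrier_mat d n"
    "P \<in> carrier_mat d n" "S \<in> carrier_mat n n" "(0\<^sub>m n n :: real mat) \<in> carrier_mat n n"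
    and AABB: "\<forall>j\<in>{1..k}. AA j \<in> carrier_mat d d" "\<forall>j\<in>{1..k}. BB j \<in> carrier_mat d n"
    and sym: "J = - J\<^sup>T" "0\<^sub>m n n = - (0\<^sub>m n n :: real mat)\<^sup>T" "S = S\<^sup>T"
    and Q: "psd_mat d Q" and M: "psd_mat (d + n) (four_block_mat R P P\<^sup>T S)"
    and phs_act: "\<forall>x\<in>carrier_vec d. \<forall>v\<in>carrier_vec n.
      drift \<Sigma> x v = (mat_A L' * Q) *\<^sub>v x + mat_B L' *\<^sub>v v \<and>
      (\<forall>j\<in>{1..k}. diffusion \<Sigma> j x v = (mat_AA L' j * Q) *\<^sub>v x + mat_BB L' j *\<^sub>v v) \<and>
      readout \<Sigma> x v = (mat_C L' * Q) *\<^sub>v x + mat_D L' *\<^sub>v v"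
    using phs unfolding L'_def phs_matrices_def system_matrices.simps
    by - (elim conjE, assumption)+
  have AA: "\<And>j. j \<in> {1..k} \<Longrightarrow> AA j \<in> carrier_mat d d"
    and BB: "\<And>j. j \<in> {1..k} \<Longrightarrow> BB j \<in> carrier_mat d n"
    using AABB by blast+
  have Qc: "Q \<in> carrier_mat d d" "Q = Q\<^sup>T"
    using Q by (auto simp: psd_mat_bform)
  have L': "system_carrier k d n L'"
    using car AA BB by (auto simp: L'_def phs_matrices_def system_carrier_def intro!: minus_carrier_mat)
  have diss: "dissipative k d n Q L'"
    unfolding dissipative_def
  proof (intro ballI)
    fix z v :: "real vec" assume zv: "z \<in> carrier_vec d" "v \<in> carrier_vec n"
    have "z @\<^sub>v v \<in> carrier_vec (d + n)"
      using zv by simp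
    then have "0 \<le> bform (four_block_mat R P P\<^sup>T S) (z @\<^sub>v v) (z @\<^sub>v v)"
      using M by (simp add: psd_mat_bform)
    then show "z \<bullet> (mat_A L' *\<^sub>v z + mat_B L' *\<^sub>v v)
        + (1/2) * (\<Sum>j=1..k. bform Q (mat_AA L' j *\<^sub>v z + mat_BB L' j *\<^sub>v v)
                                    (mat_AA L' j *\<^sub>v z + mat_BB L' j *\<^sub>v v))
        \<le> v \<bullet> (mat_C L' *\<^sub>v z + mat_D L' *\<^sub>v v)"
      using dissipation_defect[OF car sym(1,2) Qc AA BB zv L'_def] by simp
  qed
  \<comment> \<open>Both sides describe the same coefficient functions of the state, so the
    comparison identifies the state matrices of \<open>L\<close> with products such as
    \<open>mat_A L' * Q\<close>.\<close>
  have act: "mat_A L *\<^sub>v x + mat_B L *\<^sub>v v = (mat_A L' * Q) *\<^sub>v x + mat_B L' *\<^sub>v v"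
    "j \<in> {1..k} \<Longrightarrow> mat_AA L j *\<^sub>v x + mat_BB L j *\<^sub>v v = (mat_AA L' j * Q) *\<^sub>v x + mat_BB L' j *\<^sub>v v"
    "mat_C L *\<^sub>v x + mat_D L *\<^sub>v v = (mat_C L' * Q) *\<^sub>v x + mat_D L' *\<^sub>v v"
    if "x \<in> carrier_vec d" "v \<in> carrier_vec n" for x v j
    using L phs_act that by (metis+)
  have L'Q: "mat_A L' * Q \<in> carrier_mat d d" "mat_B L' \<in> carrier_mat d n"
    "j \<in> {1..k} \<Longrightarrow> mat_AA L' j * Q \<in> carrier_mat d d" "j \<in> {1..k} \<Longrightarrow> mat_BB L' j \<in> carrier_mat d n"
    "mat_C L' * Q \<in> carrier_mat n d" "mat_D L' \<in> carrier_mat n n" for j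
    using L' Qc(1) by (auto simp: system_carrier_def intro!: mult_carrier_mat[of _ _ d])
  have Lc: "mat_A L \<in> carrier_mat d d" "mat_B L \<in> carrier_mat d n"
    "j \<in> {1..k} \<Longrightarrow> mat_AA L j \<in> carrier_mat d d" "j \<in> {1..k} \<Longrightarrow> mat_BB L j \<in> carrier_mat d n"
    "mat_C L \<in> carrier_mat n d" "mat_D L \<in> carrier_mat n n" for j
    using L by blast+
  have fac: "factors_through k Q L L'"
    unfolding factors_through_def
    using action_unique[OF Lc(1) L'Q(1) Lc(2) L'Q(2) act(1)]
      action_unique[OF Lc(3) L'Q(3) Lc(4) L'Q(4) act(2)]
      action_unique[OF Lc(5) L'Q(5) Lc(6) L'Q(6) act(3)] by blast
  have "((BB j)\<^sup>T * Q * BB j)\<^sup>T = (BB j)\<^sup>T * Q * BB j" if "j \<in> {1..k}" for j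
  proof -
    note B = BB[OF that]
    have "((BB j)\<^sup>T * Q * BB j)\<^sup>T = (BB j)\<^sup>T * ((BB j)\<^sup>T * Q)\<^sup>T"
      using B Qc(1) by (intro transpose_mult[of _ n d _ n]) auto
    also have "((BB j)\<^sup>T * Q)\<^sup>T = Q\<^sup>T * BB j"
      using B Qc(1) by (subst transpose_mult[of _ n d _ d]) auto
    also have "\<dots> = Q * BB j"
      using Qc(2) by simp
    also have "(BB j)\<^sup>T * (Q * BB j) = (BB j)\<^sup>T * Q * BB j"
      using B Qc(1) by (intro assoc_mult_mat[symmetric, of _ n d _ d _ n]) auto
    finally show ?thesis .
  qed
  then have sB: "(sum_mats n n k (\<lambda>j. (BB j)\<^sup>T * Q * BB j))\<^sup>T = sum_mats n n k (\<lambda>j. (BB j)\<^sup>T * Q * BB j)"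
  proof (rule sum_mats_symmetric[rotated])
    show "(BB j)\<^sup>T * Q * BB j \<in> carrier_mat n n" if "j \<in> {1..k}" for j
      using BB[OF that] Qc(1) by (intro mult_carrier_mat[of _ n d]) auto
  qed
  have tr: "(M + c \<cdot>\<^sub>m M')\<^sup>T = M\<^sup>T + c \<cdot>\<^sub>m M'\<^sup>T"
    if "M \<in> carrier_mat n n" "M' \<in> carrier_mat n n" for c and M M' :: "real mat"
    using that by auto
  have D: "mat_D L' = S + (1/2) \<cdot>\<^sub>m sum_mats n n k (\<lambda>j. (BB j)\<^sup>T * Q * BB j)"
    using car(5) by (simp add: L'_def phs_matrices_def)
  have "(mat_D L')\<^sup>T = mat_D L'"
    unfolding D tr[OF car(5) sum_mats_carrier] sB sym(3)[symmetric] ..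
  then show thesis
    using that L' diss fac by (simp add: d_def n_def)
qed

section \<open>Block matrices and invertibility of the coupling\<close>

lemma zero_mat_mult_vec:
  "v \<in> carrier_vec c \<Longrightarrow> 0\<^sub>m r c *\<^sub>v v = (0\<^sub>v r :: real vec)"
  by auto

lemma block_diag_carrier:
  assumes "G \<in> carrier_mat r c" "H \<in> carrier_mat r' c'"
  shows "block_diag G H \<in> carrier_mat (r + r') (c + c')"
  using assms by (auto simp: block_diag_def)

lemma block_diag_mult_vec:
  assumes "G \<in> carrier_mat r c" "H \<in> carrier_mat r' c'" "x \<in> carrier_vec c" "y \<in> carrier_vec c'"
  shows "block_diag G H *\<^sub>v (x @\<^sub>v y) = (G *\<^sub>v x) @\<^sub>v (H *\<^sub>v y)"
  using assms
  by (simp add: block_diag_def four_block_mat_mult_vec[of _ r c _ c' _ r'] zero_mat_mult_vec[of _ c]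
      zero_mat_mult_vec[of _ c'])

lemma bform_block_diag:
  assumes "G \<in> carrier_mat r c" "H \<in> carrier_mat r' c'" "x \<in> carrier_vec c" "y \<in> carrier_vec c'"
    and "x' \<in> carrier_vec r" "y' \<in> carrier_vec r'"
  shows "bform (block_diag G H) (x' @\<^sub>v y') (x @\<^sub>v y) = bform G x' x + bform H y' y"
  using assms
  by (simp add: bform_def block_diag_mult_vec[of _ r c _ r' c'] scalar_prod_append[of _ r _ r'])

lemma vec_split:
  assumes "v \<in> carrier_vec (a + b)"
  obtains x y where "x \<in> carrier_vec a" "y \<in> carrier_vec b" "v = x @\<^sub>v y"
proof
  show "v = vec_first v a @\<^sub>v vec_last v b"
    using assms by simp
qed auto

lemma psd_mat_block_diag:
  assumes G: "psd_mat p G" and H: "psd_mat q H"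
  shows "psd_mat (p + q) (block_diag G H)"
proof -
  have car: "G \<in> carrier_mat p p" "H \<in> carrier_mat q q" and sym: "G\<^sup>T = G" "H\<^sup>T = H"
    using G H by (auto simp: psd_mat_bform)
  have "(block_diag G H)\<^sup>T = block_diag G H"
    using car unfolding block_diag_def
    by (subst transpose_four_block_mat[of _ p p _ q _ q]) (auto simp: sym)
  moreover have "0 \<le> bform (block_diag G H) w w" if w: "w \<in> carrier_vec (p + q)" for w
  proof -
    obtain x y where "x \<in> carrier_vec p" "y \<in> carrier_vec q" "w = x @\<^sub>v y"
      using vec_split[OF w] .
    then show ?thesis
      using G H car by (simp add: bform_block_diag[of _ p p _ q q] psd_mat_bform)
  qed
  ultimately show ?thesis
    using block_diag_carrier[OF car] by (simp add: psd_mat_bform)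
qed

section \<open>Splitting matrices and vectors at the connected ports\<close>

lemma blocks_carrier:
  assumes "M \<in> carrier_mat (r + r') (c + c')"
  shows "block_ul r c M \<in> carrier_mat r c" "block_ur r c M \<in> carrier_mat r c'"
    "block_ll r c M \<in> carrier_mat r' c" "block_lr r c M \<in> carrier_mat r' c'"
  using assms
  by (auto simp: block_ul_def block_ur_def block_ll_def block_lr_def split_block_def Let_def)

lemma blocks_mult_vec:
  assumes "M \<in> carrier_mat (r + r') (c + c')" "x \<in> carrier_vec c" "y \<in> carrier_vec c'"
  shows "M *\<^sub>v (x @\<^sub>v y) = (block_ul r c M *\<^sub>v x + block_ur r c M *\<^sub>v y)
                         @\<^sub>v (block_ll r c M *\<^sub>v x + block_lr r c M *\<^sub>v y)"
proof -
  obtain M1 M2 M3 M4 where sp: "split_block M r c = (M1, M2, M3, M4)"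
    by (metis prod_cases4)
  have "dim_row M = r + r'" "dim_col M = c + c'"
    using assms by auto
  note sb = split_block[OF sp this]
  show ?thesis
    unfolding block_ul_def block_ur_def block_ll_def block_lr_def sp prod.case
    by (subst sb(5)) (rule four_block_mat_mult_vec[OF sb(1-4) assms(2,3)])
qed

lemma cols_carrier:
  assumes "M \<in> carrier_mat r (c + c')"
  shows "left_cols c M \<in> carrier_mat r c" "right_cols c M \<in> carrier_mat r c'"
  using assms
  by (auto simp: left_cols_def right_cols_def block_ul_def block_ur_def split_block_def Let_def)

lemma cols_mult_vec:
  assumes "M \<in> carrier_mat r (c + c')" "x \<in> carrier_vec c" "y \<in> carrier_vec c'"
  shows "M *\<^sub>v (x @\<^sub>v y) = left_cols c M *\<^sub>v x + right_cols c M *\<^sub>v y"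
proof (intro eq_vecI)
  fix i assume i: "i < dim_vec (left_cols c M *\<^sub>v x + right_cols c M *\<^sub>v y)"
  note car = cols_carrier[OF assms(1)]
  have "i < r" using i car by simp
  moreover from this have "Matrix.row M i = Matrix.row (left_cols c M) i @\<^sub>v Matrix.row (right_cols c M) i"
    using assms(1)
    by (intro eq_vecI) (auto simp: left_cols_def right_cols_def block_ul_def block_ur_def
        split_block_def Let_def)
  ultimately show "(M *\<^sub>v (x @\<^sub>v y)) $ i = (left_cols c M *\<^sub>v x + right_cols c M *\<^sub>v y) $ i"
    using assms car by (simp add: scalar_prod_append[of _ c _ c'])
qed (use assms cols_carrier[OF assms(1)] in auto)

lemma rows_carrier:
  assumes "M \<in> carrier_mat (r + r') c"
  shows "upper_rows r M \<in> carrier_mat r c" "lower_rows r M \<in> carrier_mat r' c"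
  using assms
  by (auto simp: upper_rows_def lower_rows_def block_ul_def block_ll_def split_block_def Let_def)

lemma rows_mult_vec:
  assumes "M \<in> carrier_mat (r + r') c" "x \<in> carrier_vec c"
  shows "upper_rows r M *\<^sub>v x = vec_first (M *\<^sub>v x) r" "lower_rows r M *\<^sub>v x = vec_last (M *\<^sub>v x) r'"
proof -
  have "Matrix.row (upper_rows r M) i = Matrix.row M i" if "i < r" for i
    using assms that
    by (intro eq_vecI) (auto simp: upper_rows_def block_ul_def split_block_def Let_def)
  then show "upper_rows r M *\<^sub>v x = vec_first (M *\<^sub>v x) r"
    using assms rows_carrier[OF assms(1)] by (intro eq_vecI) (auto simp: vec_first_def)
  have "Matrix.row (lower_rows r M) i = Matrix.row M (r + i)" if "i < r'" for i
    using assms that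
    by (intro eq_vecI) (auto simp: lower_rows_def block_ll_def split_block_def Let_def add.commute)
  then show "lower_rows r M *\<^sub>v x = vec_last (M *\<^sub>v x) r'"
    using assms rows_carrier[OF assms(1)] by (intro eq_vecI) (auto simp: vec_last_def)
qed

lemma vec_first_last_add_append:
  fixes y :: "real vec"
  assumes "y \<in> carrier_vec (a + b)" "p \<in> carrier_vec a" "q \<in> carrier_vec b"
  shows "vec_first (y + (p @\<^sub>v q)) a = vec_first y a + p" "vec_last (y + (p @\<^sub>v q)) b = vec_last y b + q"
  using assms by (auto simp: vec_first_def vec_last_def)

section \<open>Kernels of semidefinite matrices and of the coupling matrix\<close>

lemma vec_eq_if_minus_eq_0:
  fixes x y :: "real vec"
  assumes "x \<in> carrier_vec n" "y \<in> carrier_vec n" "x - y = 0\<^sub>v n"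
  shows "x = y"
proof (intro eq_vecI)
  fix i assume "i < dim_vec y"
  then show "x $ i = y $ i"
    using assms(1,2) arg_cong[OF assms(3), of "\<lambda>v. v $ i"] by simp
qed (use assms(1,2) in auto)

lemma scalar_prod_self_eq_0:
  fixes x :: "real vec"
  assumes "x \<bullet> x = 0" "x \<in> carrier_vec n"
  shows "x = 0\<^sub>v n"
proof (intro eq_vecI)
  fix i assume "i < dim_vec (0\<^sub>v n :: real vec)"
  moreover have "(\<Sum>i = 0..<n. x $ i * x $ i) = 0"
    using assms by (simp add: scalar_prod_def)
  then have "\<forall>i\<in>{0..<n}. x $ i * x $ i = 0"
    by (subst (asm) sum_nonneg_eq_0_iff) auto
  ultimately show "x $ i = 0\<^sub>v n $ i" by auto
qed (use assms in auto)

text \<open>Minimising \<open>t \<mapsto> bform D (x + t y) (x + t y)\<close> for \<open>y = D x\<close> forces \<open>y = 0\<close>.\<close>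

lemma psd_mat_kernel:
  assumes D: "psd_mat p D" and x: "x \<in> carrier_vec p" and zero: "bform D x x = 0"
  shows "D *\<^sub>v x = 0\<^sub>v p"
proof -
  have Dc: "D \<in> carrier_mat p p" "D = D\<^sup>T" and nonneg: "\<And>v. v \<in> carrier_vec p \<Longrightarrow> 0 \<le> bform D v v"
    using D by (auto simp: psd_mat_bform)
  define y where "y = D *\<^sub>v x"
  define a b where "a = y \<bullet> y" and "b = bform D y y"
  have y: "y \<in> carrier_vec p"
    using Dc x by (simp add: y_def)
  have b: "0 \<le> b"
    using nonneg[OF y] by (simp add: b_def)
  have xy: "bform D x y = a"
    using bform_symmetric[OF Dc x y] by (simp add: bform_def y_def a_def)
  \<comment> \<open>The minimiser would be \<open>t = - a / b\<close>, but \<open>b\<close> may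
    vanish. The step \<open>- s\<close> with \<open>b + 1\<close> in the denominator already gives
    the negative value \<open>- (s * s * (b + 2))\<close> unless \<open>a = 0\<close>.\<close>
  define s where "s = a / (b + 1)"
  have a: "a = s * (b + 1)"
    using b by (simp add: s_def)
  have Dsy: "D *\<^sub>v ((- s) \<cdot>\<^sub>v y) = (- s) \<cdot>\<^sub>v (D *\<^sub>v y)"
    by (rule mult_mat_vec[OF Dc(1) y])
  have "bform D ((- s) \<cdot>\<^sub>v y) ((- s) \<cdot>\<^sub>v y) = s * s * b" "bform D x ((- s) \<cdot>\<^sub>v y) = - (s * a)"
    using Dc(1) x y xy unfolding bform_def Dsy b_def by simp_all
  then have "0 \<le> - 2 * (s * a) + s * s * b"
    using nonneg[of "x + (- s) \<cdot>\<^sub>v y"] bform_add_both[OF Dc x, of "(- s) \<cdot>\<^sub>v y"] x y zero by simp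
  also have "\<dots> = - (s * s * (b + 2))"
    by (simp add: a algebra_simps)
  finally have "s * s * (b + 2) \<le> 0"
    by simp
  then have "s * s \<le> 0"
    using b by (simp add: mult_le_0_iff)
  then have "a = 0"
    by (auto simp: a mult_le_0_iff)
  then show ?thesis
    using scalar_prod_self_eq_0[OF _ y] by (simp add: a_def y_def)
qed

text \<open>If \<open>x = K D x\<close> then \<open>x \<bullet> D x = y \<bullet> K y = 0\<close> for \<open>y = D x\<close>, so \<open>D x = 0\<close> and hence \<open>x = 0\<close>.\<close>

lemma skew_psd_coupling_invertible:
  fixes K D :: "real mat"
  assumes K: "K \<in> carrier_mat p p" "K = - K\<^sup>T" and D: "psd_mat p D"
  obtains X where "mat_inverse (1\<^sub>m p - K * D) = Some X" "X \<in> carrier_mat p p"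
    "(1\<^sub>m p - K * D) * X = 1\<^sub>m p" "X * (1\<^sub>m p - K * D) = 1\<^sub>m p"
proof -
  let ?M = "1\<^sub>m p - K * D"
  have Dc: "D \<in> carrier_mat p p"
    using D by (simp add: psd_mat_bform)
  have Mc: "?M \<in> carrier_mat p p"
    using K(1) Dc by (auto intro!: minus_carrier_mat)
  have "x = 0\<^sub>v p" if x: "x \<in> carrier_vec p" and Mx: "?M *\<^sub>v x = 0\<^sub>v p" for x
  proof -
    have y: "D *\<^sub>v x \<in> carrier_vec p"
      using Dc x by simp
    have "?M *\<^sub>v x = x - K *\<^sub>v (D *\<^sub>v x)"
      using K(1) Dc x by (simp add: minus_mult_distrib_mat_vec[of _ p p])
    then have "x - K *\<^sub>v (D *\<^sub>v x) = 0\<^sub>v p"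
      using Mx by simp
    then have fix_eq: "x = K *\<^sub>v (D *\<^sub>v x)"
      by (rule vec_eq_if_minus_eq_0[OF x mult_mat_vec_carrier[OF K(1) y]])
    \<comment> \<open>Only the left factor \<open>x\<close> is replaced; the one inside
      \<open>D *\<^sub>v x\<close> stays, so that a quadratic form of \<open>K\<close>
      appears.\<close>
    have "bform D x x = (K *\<^sub>v (D *\<^sub>v x)) \<bullet> (D *\<^sub>v x)"
      unfolding bform_def by (rule arg_cong[OF fix_eq])
    also have "\<dots> = bform K (D *\<^sub>v x) (D *\<^sub>v x)"
      using K(1) y by (simp add: bform_def comm_scalar_prod[of _ p])
    also have "\<dots> = 0"
      by (rule bform_skew[OF K y])
    finally have "D *\<^sub>v x = 0\<^sub>v p"
      by (rule psd_mat_kernel[OF D x])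
    then have "K *\<^sub>v (D *\<^sub>v x) = 0\<^sub>v p"
      using K(1) by auto
    with fix_eq show ?thesis
      by (rule trans)
  qed
  \<comment> \<open>The trivial kernel is passed through the determinant to a unit of the matrix
    ring, since \<open>mat_inverse\<close> yields \<open>None\<close> only for non-units.\<close>
  then have "Determinant.det ?M \<noteq> 0"
    using det_0_iff_vec_prod_zero_field[OF Mc] by blast
  then have "?M \<in> Units (ring_mat TYPE(real) p ())"
    by (rule det_non_zero_imp_unit[OF Mc])
  then obtain X where "mat_inverse ?M = Some X"
    using mat_inverse(1)[OF Mc, of "()"] by (cases "mat_inverse ?M") auto
  then show thesis
    using that mat_inverse(2)[OF Mc] by blast
qed

section \<open>Closing the feedback loop\<close>

text \<open>Drift, diffusion and output of the interconnection share one shape. \<open>G\<close>,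
  \<open>H\<close>, \<open>E\<close> are the coefficients of state, connected control and external
  control; \<open>U z + V v\<close> is the connected output without the contribution of the
  connected controls. Inserting the solved loop for \<open>c1\<close>, \<open>c2\<close> decouples
  the two systems.\<close>

lemma closed_loop_mult_vec:
  fixes c1 c2 :: "real vec"
  assumes G: "G1 \<in> carrier_mat r1 d1" "G2 \<in> carrier_mat r2 d2"
    and H: "H1 \<in> carrier_mat r1 m" "H2 \<in> carrier_mat r2 m"
    and E: "E1 \<in> carrier_mat r1 e1" "E2 \<in> carrier_mat r2 e2"
    and U: "U1 \<in> carrier_mat m d1" "U2 \<in> carrier_mat m d2"
    and V: "V1 \<in> carrier_mat m e1" "V2 \<in> carrier_mat m e2"
    and X: "X \<in> carrier_mat (m + m) (m + m)" and K: "K \<in> carrier_mat (m + m) (m + m)"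
    and z: "z1 \<in> carrier_vec d1" "z2 \<in> carrier_vec d2"
    and v: "v1 \<in> carrier_vec e1" "v2 \<in> carrier_vec e2"
    and c: "c1 \<in> carrier_vec m" "c2 \<in> carrier_vec m"
    and loop: "c1 @\<^sub>v c2 = X *\<^sub>v (K *\<^sub>v ((U1 *\<^sub>v z1 + V1 *\<^sub>v v1) @\<^sub>v (U2 *\<^sub>v z2 + V2 *\<^sub>v v2)))"
  shows "(block_diag G1 G2 + block_diag H1 H2 * X * K * block_diag U1 U2) *\<^sub>v (z1 @\<^sub>v z2)
         + (block_diag H1 H2 * X * K * block_diag V1 V2 + block_diag E1 E2) *\<^sub>v (v1 @\<^sub>v v2)
       = (G1 *\<^sub>v z1 + (H1 *\<^sub>v c1 + E1 *\<^sub>v v1)) @\<^sub>v (G2 *\<^sub>v z2 + (H2 *\<^sub>v c2 + E2 *\<^sub>v v2))"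
proof -
  let ?d = "d1 + d2" and ?r = "r1 + r2" and ?e = "e1 + e2" and ?m = "m + m"
  define G H E U V where "G = block_diag G1 G2" and "H = block_diag H1 H2" and "E = block_diag E1 E2"
    and "U = block_diag U1 U2" and "V = block_diag V1 V2"
  note defs = G_def H_def E_def U_def V_def
  have car: "G \<in> carrier_mat ?r ?d" "H \<in> carrier_mat ?r ?m" "E \<in> carrier_mat ?r ?e"
    "U \<in> carrier_mat ?m ?d" "V \<in> carrier_mat ?m ?e"
    unfolding defs using G H E U V by (auto intro: block_diag_carrier)
  define z v where "z = z1 @\<^sub>v z2" and "v = v1 @\<^sub>v v2"
  have zv: "z \<in> carrier_vec ?d" "v \<in> carrier_vec ?e"
    using z v by (auto simp: z_def v_def)
  have Uz: "U *\<^sub>v z = (U1 *\<^sub>v z1) @\<^sub>v (U2 *\<^sub>v z2)" and Gz: "G *\<^sub>v z = (G1 *\<^sub>v z1) @\<^sub>v (G2 *\<^sub>v z2)"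
    unfolding defs z_def by (rule block_diag_mult_vec[OF U z] block_diag_mult_vec[OF G z])+
  have Vv: "V *\<^sub>v v = (V1 *\<^sub>v v1) @\<^sub>v (V2 *\<^sub>v v2)" and Ev: "E *\<^sub>v v = (E1 *\<^sub>v v1) @\<^sub>v (E2 *\<^sub>v v2)"
    unfolding defs v_def by (rule block_diag_mult_vec[OF V v] block_diag_mult_vec[OF E v])+
  have Hc: "H *\<^sub>v (c1 @\<^sub>v c2) = (H1 *\<^sub>v c1) @\<^sub>v (H2 *\<^sub>v c2)"
    unfolding defs by (rule block_diag_mult_vec[OF H c])
  have "U *\<^sub>v z + V *\<^sub>v v = (U1 *\<^sub>v z1 + V1 *\<^sub>v v1) @\<^sub>v (U2 *\<^sub>v z2 + V2 *\<^sub>v v2)"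
    unfolding Uz Vv using U V z v by (intro append_vec_add[of _ m _ _ m]) auto
  then have loop': "c1 @\<^sub>v c2 = X *\<^sub>v (K *\<^sub>v (U *\<^sub>v z + V *\<^sub>v v))"
    using loop by simp
  have HX: "H * X \<in> carrier_mat ?r ?m" and HXK: "H * X * K \<in> carrier_mat ?r ?m"
    using car(2) X K by auto
  have HXKU: "H * X * K * U \<in> carrier_mat ?r ?d" and HXKV: "H * X * K * V \<in> carrier_mat ?r ?e"
    using HXK car by auto
  have step: "(H * X * K * M) *\<^sub>v w = H *\<^sub>v (X *\<^sub>v (K *\<^sub>v (M *\<^sub>v w)))"
    if M: "M \<in> carrier_mat ?m p" and w: "w \<in> carrier_vec p" for M w p
  proof -
    have Mw: "M *\<^sub>v w \<in> carrier_vec ?m" and KMw: "K *\<^sub>v (M *\<^sub>v w) \<in> carrier_vec ?m"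
      using M w K by auto
    show ?thesis
      unfolding assoc_mult_mat_vec[OF HXK M w] assoc_mult_mat_vec[OF HX K Mw]
        assoc_mult_mat_vec[OF car(2) X KMw] ..
  qed
  have lin: "M *\<^sub>v (a + b) = M *\<^sub>v a + M *\<^sub>v b"
    if "M \<in> carrier_mat p q" "a \<in> carrier_vec q" "b \<in> carrier_vec q" for M :: "real mat" and a b p q
    using that by (rule mult_add_distrib_mat_vec)
  have Uzc: "U *\<^sub>v z \<in> carrier_vec ?m" and Vvc: "V *\<^sub>v v \<in> carrier_vec ?m"
    using car zv by auto
  \<comment> \<open>The loop equation enters here: the effect of the connected controls splits into
    a state part and an external part. The rest is regrouping.\<close>
  have "H *\<^sub>v (c1 @\<^sub>v c2) = H *\<^sub>v (X *\<^sub>v (K *\<^sub>v (U *\<^sub>v z))) + H *\<^sub>v (X *\<^sub>v (K *\<^sub>v (V *\<^sub>v v)))"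
    unfolding loop' using car(2) X K Uzc Vvc
    by (simp add: lin[OF K] lin[OF X] lin[OF car(2)])
  then have Hc': "H *\<^sub>v (c1 @\<^sub>v c2) = (H * X * K * U) *\<^sub>v z + (H * X * K * V) *\<^sub>v v"
    using step[OF car(4) zv(1)] step[OF car(5) zv(2)] by simp
  have "(G + H * X * K * U) *\<^sub>v z + (H * X * K * V + E) *\<^sub>v v
      = (G *\<^sub>v z + (H * X * K * U) *\<^sub>v z) + ((H * X * K * V) *\<^sub>v v + E *\<^sub>v v)"
    unfolding add_mult_distrib_mat_vec[OF car(1) HXKU zv(1)]
      add_mult_distrib_mat_vec[OF HXKV car(3) zv(2)] ..
  also have "\<dots> = G *\<^sub>v z + (H *\<^sub>v (c1 @\<^sub>v c2) + E *\<^sub>v v)"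
    unfolding Hc' using car HXKU HXKV zv
    by (intro eq_vecI) (auto simp del: index_mult_mat_vec)
  also have "\<dots> = (G1 *\<^sub>v z1 + (H1 *\<^sub>v c1 + E1 *\<^sub>v v1)) @\<^sub>v (G2 *\<^sub>v z2 + (H2 *\<^sub>v c2 + E2 *\<^sub>v v2))"
    unfolding Gz Hc Ev using G H E z v c
    by (subst append_vec_add[of _ r1 _ _ r2]; simp)+
  finally show ?thesis
    unfolding defs z_def v_def .
qed

text \<open>
  The connected controls \<open>(c1, c2)\<close> that solve the interconnection relation when \<open>y1\<close>, \<open>y2\<close> are the
  state contributions \<open>C(1) z1\<close>, \<open>C(2) z2\<close> to the outputs and \<open>v1\<close>, \<open>v2\<close> the external controls.
\<close>

definition feedback_input ::
  "nat \<Rightarrow> real mat \<Rightarrow> system_matrices \<Rightarrow> system_matrices \<Rightarrow>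
   real vec \<Rightarrow> real vec \<Rightarrow> real vec \<Rightarrow> real vec \<Rightarrow> real vec" where
  "feedback_input m K L1 L2 y1 y2 v1 v2 =
     the (mat_inverse (coupling_mat m K L1 L2)) *\<^sub>v
       (K *\<^sub>v ((vec_first y1 m + block_ur m m (mat_D L1) *\<^sub>v v1)
             @\<^sub>v (vec_first y2 m + block_ur m m (mat_D L2) *\<^sub>v v2)))"

lemma interconnection_carrier:
  assumes L: "system_carrier k d1 (m + e1) L1" "system_carrier k d2 (m + e2) L2"
    and K: "K \<in> carrier_mat (m + m) (m + m)"
    and X: "the (mat_inverse (coupling_mat m K L1 L2)) \<in> carrier_mat (m + m) (m + m)"
  shows "system_carrier k (d1 + d2) (e1 + e2) (interconnection_matrices m K L1 L2)"
  unfolding system_carrier_def interconnection_matrices_def Let_def system_matrices.simps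
  using L K X
  by (auto simp: system_carrier_def
      intro!: block_diag_carrier add_carrier_mat mult_carrier_mat[of _ _ "m + m"]
        cols_carrier rows_carrier blocks_carrier)

text \<open>This is the access to the closed formulas: once the connected controls are named, the
  interconnection is two separate systems side by side, with only the external outputs kept.
  Dissipativity and the factor \<open>Q\<close> can then be handled for each system on its
  own.\<close>

lemma interconnection_mult_vec:
  assumes L: "system_carrier k d1 (m + e1) L1" "system_carrier k d2 (m + e2) L2"
    and K: "K \<in> carrier_mat (m + m) (m + m)"
    and X: "the (mat_inverse (coupling_mat m K L1 L2)) \<in> carrier_mat (m + m) (m + m)"
    and z: "z1 \<in> carrier_vec d1" "z2 \<in> carrier_vec d2"
    and v: "v1 \<in> carrier_vec e1" "v2 \<in> carrier_vec e2"
    and c: "c1 \<in> carrier_vec m" "c2 \<in> carrier_vec m"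
    and loop: "c1 @\<^sub>v c2 = feedback_input m K L1 L2 (mat_C L1 *\<^sub>v z1) (mat_C L2 *\<^sub>v z2) v1 v2"
    and I: "I = interconnection_matrices m K L1 L2"
  shows
    "mat_A I *\<^sub>v (z1 @\<^sub>v z2) + mat_B I *\<^sub>v (v1 @\<^sub>v v2)
     = (mat_A L1 *\<^sub>v z1 + mat_B L1 *\<^sub>v (c1 @\<^sub>v v1)) @\<^sub>v (mat_A L2 *\<^sub>v z2 + mat_B L2 *\<^sub>v (c2 @\<^sub>v v2))"
    "j \<in> {1..k} \<Longrightarrow> mat_AA I j *\<^sub>v (z1 @\<^sub>v z2) + mat_BB I j *\<^sub>v (v1 @\<^sub>v v2)
     = (mat_AA L1 j *\<^sub>v z1 + mat_BB L1 j *\<^sub>v (c1 @\<^sub>v v1)) @\<^sub>v (mat_AA L2 j *\<^sub>v z2 + mat_BB L2 j *\<^sub>v (c2 @\<^sub>v v2))"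
    "mat_C I *\<^sub>v (z1 @\<^sub>v z2) + mat_D I *\<^sub>v (v1 @\<^sub>v v2)
     = vec_last (mat_C L1 *\<^sub>v z1 + mat_D L1 *\<^sub>v (c1 @\<^sub>v v1)) e1
       @\<^sub>v vec_last (mat_C L2 *\<^sub>v z2 + mat_D L2 *\<^sub>v (c2 @\<^sub>v v2)) e2"
proof -
  have A: "mat_A L1 \<in> carrier_mat d1 d1" "mat_A L2 \<in> carrier_mat d2 d2"
    and B: "mat_B L1 \<in> carrier_mat d1 (m + e1)" "mat_B L2 \<in> carrier_mat d2 (m + e2)"
    and C: "mat_C L1 \<in> carrier_mat (m + e1) d1" "mat_C L2 \<in> carrier_mat (m + e2) d2"
    and D: "mat_D L1 \<in> carrier_mat (m + e1) (m + e1)" "mat_D L2 \<in> carrier_mat (m + e2) (m + e2)"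
    using L by (auto simp: system_carrier_def)
  note loop = loop[unfolded feedback_input_def rows_mult_vec(1)[OF C(1) z(1), symmetric]
      rows_mult_vec(1)[OF C(2) z(2), symmetric]]
  \<comment> \<open>The loop data \<open>U\<close>, \<open>V\<close> (upper rows of
    \<open>C\<close>, upper right block of \<open>D\<close>) are common to all three equations; only
    \<open>G\<close>, \<open>H\<close>, \<open>E\<close> vary. For the output they are the lower
    rows of \<open>C\<close> and the lower blocks of \<open>D\<close>.\<close>
  note rule = closed_loop_mult_vec[OF _ _ _ _ _ _ rows_carrier(1)[OF C(1)] rows_carrier(1)[OF C(2)]
      blocks_carrier(2)[OF D(1)] blocks_carrier(2)[OF D(2)] X K z v c loop]
  show "mat_A I *\<^sub>v (z1 @\<^sub>v z2) + mat_B I *\<^sub>v (v1 @\<^sub>v v2)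
     = (mat_A L1 *\<^sub>v z1 + mat_B L1 *\<^sub>v (c1 @\<^sub>v v1)) @\<^sub>v (mat_A L2 *\<^sub>v z2 + mat_B L2 *\<^sub>v (c2 @\<^sub>v v2))"
    unfolding I interconnection_matrices_def Let_def system_matrices.simps
      cols_mult_vec[OF B(1) c(1) v(1)] cols_mult_vec[OF B(2) c(2) v(2)]
    by (rule rule[OF A cols_carrier(1)[OF B(1)] cols_carrier(1)[OF B(2)]
          cols_carrier(2)[OF B(1)] cols_carrier(2)[OF B(2)]])
  show "mat_AA I j *\<^sub>v (z1 @\<^sub>v z2) + mat_BB I j *\<^sub>v (v1 @\<^sub>v v2)
     = (mat_AA L1 j *\<^sub>v z1 + mat_BB L1 j *\<^sub>v (c1 @\<^sub>v v1)) @\<^sub>v (mat_AA L2 j *\<^sub>v z2 + mat_BB L2 j *\<^sub>v (c2 @\<^sub>v v2))"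
    if "j \<in> {1..k}"
  proof -
    have AA: "mat_AA L1 j \<in> carrier_mat d1 d1" "mat_AA L2 j \<in> carrier_mat d2 d2"
      and BB: "mat_BB L1 j \<in> carrier_mat d1 (m + e1)" "mat_BB L2 j \<in> carrier_mat d2 (m + e2)"
      using L \<open>j \<in> {1..k}\<close> by (auto simp: system_carrier_def)
    show ?thesis
      unfolding I interconnection_matrices_def Let_def system_matrices.simps
        cols_mult_vec[OF BB(1) c(1) v(1)] cols_mult_vec[OF BB(2) c(2) v(2)]
      by (rule rule[OF AA cols_carrier(1)[OF BB(1)] cols_carrier(1)[OF BB(2)]
            cols_carrier(2)[OF BB(1)] cols_carrier(2)[OF BB(2)]])
  qed
  have out: "vec_last (mat_C L *\<^sub>v z + mat_D L *\<^sub>v (c @\<^sub>v v)) e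
      = lower_rows m (mat_C L) *\<^sub>v z + (block_ll m m (mat_D L) *\<^sub>v c + block_lr m m (mat_D L) *\<^sub>v v)"
    if "mat_C L \<in> carrier_mat (m + e) d" "mat_D L \<in> carrier_mat (m + e) (m + e)"
      "z \<in> carrier_vec d" "c \<in> carrier_vec m" "v \<in> carrier_vec e" for L z c v e d
    unfolding blocks_mult_vec[OF that(2,4,5)] rows_mult_vec(2)[OF that(1,3)]
    using that blocks_carrier[OF that(2)]
    by (intro vec_first_last_add_append(2)[of _ m]) auto
  show "mat_C I *\<^sub>v (z1 @\<^sub>v z2) + mat_D I *\<^sub>v (v1 @\<^sub>v v2)
     = vec_last (mat_C L1 *\<^sub>v z1 + mat_D L1 *\<^sub>v (c1 @\<^sub>v v1)) e1
       @\<^sub>v vec_last (mat_C L2 *\<^sub>v z2 + mat_D L2 *\<^sub>v (c2 @\<^sub>v v2)) e2"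
    unfolding I interconnection_matrices_def Let_def system_matrices.simps
      out[OF C(1) D(1) z(1) c(1) v(1)] out[OF C(2) D(2) z(2) c(2) v(2)]
    by (rule rule[OF rows_carrier(2)[OF C(1)] rows_carrier(2)[OF C(2)]
          blocks_carrier(3)[OF D(1)] blocks_carrier(3)[OF D(2)]
          blocks_carrier(4)[OF D(1)] blocks_carrier(4)[OF D(2)]])
qed

section \<open>The interconnection relation solved for the connected controls\<close>

lemma coupling_mat_altdef:
  "coupling_mat m K L1 L2 =
     1\<^sub>m (m + m) - K * block_diag (block_ul m m (mat_D L1)) (block_ul m m (mat_D L2))"
  by (simp add: coupling_mat_def mult_2)

text \<open>With \<open>W\<close> the connected feedthrough, the coupling matrix is
  \<open>1 - K W\<close>. Applied to \<open>c = X K w\<close> it gives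
  \<open>c - K W c = K w\<close>, that is \<open>c = K (w + W c)\<close>, and \<open>w + W c\<close>
  is the full connected output.\<close>

lemma feedback_input_fixpoint:
  assumes D: "mat_D L1 \<in> carrier_mat (m + e1) (m + e1)" "mat_D L2 \<in> carrier_mat (m + e2) (m + e2)"
    and K: "K \<in> carrier_mat (m + m) (m + m)"
    and X: "mat_inverse (coupling_mat m K L1 L2) = Some X" "X \<in> carrier_mat (m + m) (m + m)"
      "coupling_mat m K L1 L2 * X = 1\<^sub>m (m + m)"
    and y: "y1 \<in> carrier_vec (m + e1)" "y2 \<in> carrier_vec (m + e2)"
    and v: "v1 \<in> carrier_vec e1" "v2 \<in> carrier_vec e2"
    and c: "c1 \<in> carrier_vec m" "c2 \<in> carrier_vec m"
    and loop: "c1 @\<^sub>v c2 = feedback_input m K L1 L2 y1 y2 v1 v2"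
  shows "c1 @\<^sub>v c2 = K *\<^sub>v (vec_first (y1 + mat_D L1 *\<^sub>v (c1 @\<^sub>v v1)) m
                         @\<^sub>v vec_first (y2 + mat_D L2 *\<^sub>v (c2 @\<^sub>v v2)) m)"
proof -
  let ?m = "m + m"
  define W where "W = block_diag (block_ul m m (mat_D L1)) (block_ul m m (mat_D L2))"
  define w where "w = (vec_first y1 m + block_ur m m (mat_D L1) *\<^sub>v v1)
             @\<^sub>v (vec_first y2 m + block_ur m m (mat_D L2) *\<^sub>v v2)"
  note bc1 = blocks_carrier[OF D(1)] and bc2 = blocks_carrier[OF D(2)]
  have W: "W \<in> carrier_mat ?m ?m"
    unfolding W_def by (rule block_diag_carrier[OF bc1(1) bc2(1)])
  have w: "w \<in> carrier_vec ?m"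
    unfolding w_def using bc1(2) bc2(2) v by auto
  define cc where "cc = c1 @\<^sub>v c2"
  have cc: "cc \<in> carrier_vec ?m"
    using c by (simp add: cc_def)
  have Kw: "K *\<^sub>v w \<in> carrier_vec ?m" and Wc: "W *\<^sub>v cc \<in> carrier_vec ?m"
    using K w W cc by auto
  have KW: "K * W \<in> carrier_mat ?m ?m"
    using K W by auto
  then have M: "coupling_mat m K L1 L2 \<in> carrier_mat ?m ?m"
    unfolding coupling_mat_altdef W_def by (intro minus_carrier_mat)
  have "cc = X *\<^sub>v (K *\<^sub>v w)"
    using loop X(1) by (simp add: cc_def feedback_input_def w_def)
  then have "coupling_mat m K L1 L2 *\<^sub>v cc = (coupling_mat m K L1 L2 * X) *\<^sub>v (K *\<^sub>v w)"
    using assoc_mult_mat_vec[OF M X(2) Kw] by simp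
  also have "\<dots> = K *\<^sub>v w"
    using Kw by (simp add: X(3))
  finally have "coupling_mat m K L1 L2 *\<^sub>v cc = K *\<^sub>v w" .
  moreover have "coupling_mat m K L1 L2 *\<^sub>v cc = cc - K *\<^sub>v (W *\<^sub>v cc)"
    unfolding coupling_mat_altdef W_def[symmetric]
    using minus_mult_distrib_mat_vec[OF one_carrier_mat KW cc] assoc_mult_mat_vec[OF K W cc] cc by simp
  ultimately have eq: "cc - K *\<^sub>v (W *\<^sub>v cc) = K *\<^sub>v w"
    by simp
  have "cc = K *\<^sub>v w + K *\<^sub>v (W *\<^sub>v cc)"
  proof (intro eq_vecI)
    fix i assume "i < dim_vec (K *\<^sub>v w + K *\<^sub>v (W *\<^sub>v cc))"
    then have "i < ?m" using K by simp
    then show "cc $ i = (K *\<^sub>v w + K *\<^sub>v (W *\<^sub>v cc)) $ i"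
      using arg_cong[OF eq, of "\<lambda>u. u $ i"] cc K by (simp del: index_mult_mat_vec)
  qed (use cc K in simp)
  also have "\<dots> = K *\<^sub>v (w + W *\<^sub>v cc)"
    by (rule mult_add_distrib_mat_vec[OF K w Wc, symmetric])
  also have "w + W *\<^sub>v cc = vec_first (y1 + mat_D L1 *\<^sub>v (c1 @\<^sub>v v1)) m
                         @\<^sub>v vec_first (y2 + mat_D L2 *\<^sub>v (c2 @\<^sub>v v2)) m"
  proof -
    have "W *\<^sub>v cc = (block_ul m m (mat_D L1) *\<^sub>v c1) @\<^sub>v (block_ul m m (mat_D L2) *\<^sub>v c2)"
      unfolding W_def cc_def by (rule block_diag_mult_vec[OF bc1(1) bc2(1) c])
    then have "w + W *\<^sub>v cc
      = (vec_first y1 m + block_ur m m (mat_D L1) *\<^sub>v v1 + block_ul m m (mat_D L1) *\<^sub>v c1)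
        @\<^sub>v (vec_first y2 m + block_ur m m (mat_D L2) *\<^sub>v v2 + block_ul m m (mat_D L2) *\<^sub>v c2)"
      unfolding w_def using bc1 bc2 c v by (simp add: append_vec_add[of _ m _ _ m])
    moreover have "vec_first (y + M *\<^sub>v (a @\<^sub>v b)) m
        = vec_first y m + block_ur m m M *\<^sub>v b + block_ul m m M *\<^sub>v a"
      if "M \<in> carrier_mat (m + e) (m + e)" "y \<in> carrier_vec (m + e)" "a \<in> carrier_vec m" "b \<in> carrier_vec e"
      for M y a b e
    proof -
      note bc = blocks_carrier[OF that(1)]
      have "vec_first (y + M *\<^sub>v (a @\<^sub>v b)) m = vec_first y m + (block_ul m m M *\<^sub>v a + block_ur m m M *\<^sub>v b)"
        unfolding blocks_mult_vec[OF that(1,3,4)]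
        using that bc by (intro vec_first_last_add_append(1)[of _ _ e]) auto
      then show ?thesis
        using bc that by (auto simp del: index_mult_mat_vec)
    qed
    ultimately show ?thesis
      using D y c v by simp
  qed
  finally show ?thesis
    by (simp add: cc_def)
qed

section \<open>The interconnected system\<close>

text \<open>At zero co-state and zero external control the dissipation inequality bounds the noise
  term, nonnegative because \<open>Q\<close> is, by the quadratic form of the connected
  feedthrough.\<close>

lemma psd_mat_block_ul_feedthrough:
  assumes L: "system_carrier k d (m + e) L" and Q: "psd_mat d Q"
    and diss: "dissipative k d (m + e) Q L" and sym: "(mat_D L)\<^sup>T = mat_D L"
  shows "psd_mat m (block_ul m m (mat_D L))"
proof -
  have C: "mat_C L \<in> carrier_mat (m + e) d" and D: "mat_D L \<in> carrier_mat (m + e) (m + e)"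
    and A: "mat_A L \<in> carrier_mat d d" and B: "mat_B L \<in> carrier_mat d (m + e)"
    using L by (auto simp: system_carrier_def)
  note bc = blocks_carrier[OF D]
  have "mat_D L $$ (i, j) = mat_D L $$ (j, i)" if "i < m + e" "j < m + e" for i j
    using that D arg_cong[OF sym, of "\<lambda>M. M $$ (i, j)"] by simp
  then have "(block_ul m m (mat_D L))\<^sup>T = block_ul m m (mat_D L)"
    by (intro eq_matI) (auto simp: block_ul_def split_block_def Let_def)
  moreover have "0 \<le> bform (block_ul m m (mat_D L)) a a" if a: "a \<in> carrier_vec m" for a
  proof -
    define v where "v = a @\<^sub>v 0\<^sub>v e"
    have v: "v \<in> carrier_vec (m + e)"
      using a by (simp add: v_def)
    have nonneg: "0 \<le> bform Q (mat_AA L j *\<^sub>v 0\<^sub>v d + mat_BB L j *\<^sub>v v) (mat_AA L j *\<^sub>v 0\<^sub>v d + mat_BB L j *\<^sub>v v)"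
      if "j \<in> {1..k}" for j
    proof -
      have "mat_AA L j *\<^sub>v 0\<^sub>v d + mat_BB L j *\<^sub>v v \<in> carrier_vec d"
        using L that v
        by (auto simp: system_carrier_def intro!: add_carrier_vec mult_mat_vec_carrier[of _ d])
      then show ?thesis
        using Q by (simp add: psd_mat_bform)
    qed
    have C0: "mat_C L *\<^sub>v 0\<^sub>v d = 0\<^sub>v (m + e)"
      using C by auto
    have "0 \<le> (\<Sum>j=1..k. bform Q (mat_AA L j *\<^sub>v 0\<^sub>v d + mat_BB L j *\<^sub>v v)
                            (mat_AA L j *\<^sub>v 0\<^sub>v d + mat_BB L j *\<^sub>v v))"
      by (intro sum_nonneg nonneg)
    moreover have "0\<^sub>v d \<bullet> (mat_A L *\<^sub>v 0\<^sub>v d + mat_B L *\<^sub>v v) = 0"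
      using A B v by (intro scalar_prod_left_zero add_carrier_vec mult_mat_vec_carrier) auto
    moreover have "mat_C L *\<^sub>v 0\<^sub>v d + mat_D L *\<^sub>v v = mat_D L *\<^sub>v v"
      unfolding C0 using mult_mat_vec_carrier[OF D v] by (rule left_zero_vec)
    ultimately have "0 \<le> v \<bullet> (mat_D L *\<^sub>v v)"
      using diss[unfolded dissipative_def, rule_format, OF zero_carrier_vec v] by simp
    also have "v \<bullet> (mat_D L *\<^sub>v v)
        = a \<bullet> (block_ul m m (mat_D L) *\<^sub>v a + block_ur m m (mat_D L) *\<^sub>v 0\<^sub>v e)
          + 0\<^sub>v e \<bullet> (block_ll m m (mat_D L) *\<^sub>v a + block_lr m m (mat_D L) *\<^sub>v 0\<^sub>v e)"
      unfolding v_def blocks_mult_vec[OF D a zero_carrier_vec]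
      using a bc by (intro scalar_prod_append[of _ m _ e]) auto
    also have "0\<^sub>v e \<bullet> (block_ll m m (mat_D L) *\<^sub>v a + block_lr m m (mat_D L) *\<^sub>v 0\<^sub>v e) = 0"
      using a bc by (intro scalar_prod_left_zero add_carrier_vec mult_mat_vec_carrier) auto
    also have "block_ur m m (mat_D L) *\<^sub>v 0\<^sub>v e = 0\<^sub>v m"
      using bc(2) by auto
    also have "block_ul m m (mat_D L) *\<^sub>v a + 0\<^sub>v m = block_ul m m (mat_D L) *\<^sub>v a"
      using mult_mat_vec_carrier[OF bc(1) a] by (rule right_zero_vec)
    finally show ?thesis
      by (simp add: bform_def)
  qed
  ultimately show ?thesis
    using bc(1) by (simp add: psd_mat_bform)
qed

text \<open>
  The inner products of the connected ports add up to \<open>y \<bullet> (K *\<^sub>v y) = 0\<close>, so adding the two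
  dissipation inequalities leaves the supply rate of the external ports.
\<close>

lemma interconnection_dissipative:
  assumes L: "system_carrier k d1 (m + e1) L1" "system_carrier k d2 (m + e2) L2"
    and Q: "Q1 \<in> carrier_mat d1 d1" "Q2 \<in> carrier_mat d2 d2"
    and diss: "dissipative k d1 (m + e1) Q1 L1" "dissipative k d2 (m + e2) Q2 L2"
    and K: "K \<in> carrier_mat (m + m) (m + m)" "K = - K\<^sup>T"
    and X: "mat_inverse (coupling_mat m K L1 L2) = Some X" "X \<in> carrier_mat (m + m) (m + m)"
      "coupling_mat m K L1 L2 * X = 1\<^sub>m (m + m)"
  shows "dissipative k (d1 + d2) (e1 + e2) (block_diag Q1 Q2) (interconnection_matrices m K L1 L2)"
  unfolding dissipative_def
proof (intro ballI)
  fix z v :: "real vec"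
  assume "z \<in> carrier_vec (d1 + d2)" "v \<in> carrier_vec (e1 + e2)"
  then obtain z1 z2 v1 v2 where z: "z1 \<in> carrier_vec d1" "z2 \<in> carrier_vec d2" "z = z1 @\<^sub>v z2"
    and v: "v1 \<in> carrier_vec e1" "v2 \<in> carrier_vec e2" "v = v1 @\<^sub>v v2"
    by (elim vec_split) blast
  define I where "I = interconnection_matrices m K L1 L2"
  have C: "mat_C L1 \<in> carrier_mat (m + e1) d1" "mat_C L2 \<in> carrier_mat (m + e2) d2"
    and D: "mat_D L1 \<in> carrier_mat (m + e1) (m + e1)" "mat_D L2 \<in> carrier_mat (m + e2) (m + e2)"
    and A: "mat_A L1 \<in> carrier_mat d1 d1" "mat_A L2 \<in> carrier_mat d2 d2"
    and B: "mat_B L1 \<in> carrier_mat d1 (m + e1)" "mat_B L2 \<in> carrier_mat d2 (m + e2)"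
    using L by (auto simp: system_carrier_def)
  have X': "the (mat_inverse (coupling_mat m K L1 L2)) \<in> carrier_mat (m + m) (m + m)"
    using X by simp
  \<comment> \<open>For fixed \<open>z\<close> and \<open>v\<close> the loop produces definite
    connected controls. Each system is then considered alone, with its control completed by
    them.\<close>
  have "feedback_input m K L1 L2 (mat_C L1 *\<^sub>v z1) (mat_C L2 *\<^sub>v z2) v1 v2 \<in> carrier_vec (m + m)"
    unfolding feedback_input_def by (intro mult_mat_vec_carrier[OF X'] mult_mat_vec_carrier[OF K(1)])
      (use blocks_carrier(2)[OF D(1)] blocks_carrier(2)[OF D(2)] v in auto)
  then obtain c1 c2 where c: "c1 \<in> carrier_vec m" "c2 \<in> carrier_vec m"
    and loop: "c1 @\<^sub>v c2 = feedback_input m K L1 L2 (mat_C L1 *\<^sub>v z1) (mat_C L2 *\<^sub>v z2) v1 v2"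
    by (elim vec_split) metis
  note act = interconnection_mult_vec[OF L K(1) X' z(1,2) v(1,2) c loop I_def, folded z(3) v(3)]
  define f1 f2 where "f1 = mat_A L1 *\<^sub>v z1 + mat_B L1 *\<^sub>v (c1 @\<^sub>v v1)"
    and "f2 = mat_A L2 *\<^sub>v z2 + mat_B L2 *\<^sub>v (c2 @\<^sub>v v2)"
  define s1 s2 where "s1 = (\<lambda>j. mat_AA L1 j *\<^sub>v z1 + mat_BB L1 j *\<^sub>v (c1 @\<^sub>v v1))"
    and "s2 = (\<lambda>j. mat_AA L2 j *\<^sub>v z2 + mat_BB L2 j *\<^sub>v (c2 @\<^sub>v v2))"
  define y1 y2 where "y1 = mat_C L1 *\<^sub>v z1 + mat_D L1 *\<^sub>v (c1 @\<^sub>v v1)"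
    and "y2 = mat_C L2 *\<^sub>v z2 + mat_D L2 *\<^sub>v (c2 @\<^sub>v v2)"
  note act = act[folded f1_def f2_def y1_def y2_def]
  have cv: "c1 @\<^sub>v v1 \<in> carrier_vec (m + e1)" "c2 @\<^sub>v v2 \<in> carrier_vec (m + e2)"
    using c v by auto
  have f: "f1 \<in> carrier_vec d1" "f2 \<in> carrier_vec d2"
    using A B z cv unfolding f1_def f2_def by (auto intro!: add_carrier_vec mult_mat_vec_carrier)
  have y: "y1 \<in> carrier_vec (m + e1)" "y2 \<in> carrier_vec (m + e2)"
    using C D z cv unfolding y1_def y2_def by (auto intro!: add_carrier_vec mult_mat_vec_carrier)
  have s: "s1 j \<in> carrier_vec d1" "s2 j \<in> carrier_vec d2" if "j \<in> {1..k}" for j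
  proof -
    have "mat_AA L1 j \<in> carrier_mat d1 d1" "mat_AA L2 j \<in> carrier_mat d2 d2"
      "mat_BB L1 j \<in> carrier_mat d1 (m + e1)" "mat_BB L2 j \<in> carrier_mat d2 (m + e2)"
      using L that by (auto simp: system_carrier_def)
    then show "s1 j \<in> carrier_vec d1" "s2 j \<in> carrier_vec d2"
      unfolding s1_def s2_def using z cv by (auto intro!: add_carrier_vec mult_mat_vec_carrier)
  qed
  have state: "z \<bullet> (f1 @\<^sub>v f2) = z1 \<bullet> f1 + z2 \<bullet> f2"
    unfolding z(3) by (rule scalar_prod_append[OF z(1,2) f])
  have noise: "(\<Sum>j=1..k. bform (block_diag Q1 Q2) (mat_AA I j *\<^sub>v z + mat_BB I j *\<^sub>v v)
                               (mat_AA I j *\<^sub>v z + mat_BB I j *\<^sub>v v))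
      = (\<Sum>j=1..k. bform Q1 (s1 j) (s1 j)) + (\<Sum>j=1..k. bform Q2 (s2 j) (s2 j))"
    unfolding sum.distrib[symmetric]
  proof (intro sum.cong refl)
    fix j assume j: "j \<in> {1..k}"
    show "bform (block_diag Q1 Q2) (mat_AA I j *\<^sub>v z + mat_BB I j *\<^sub>v v) (mat_AA I j *\<^sub>v z + mat_BB I j *\<^sub>v v)
        = bform Q1 (s1 j) (s1 j) + bform Q2 (s2 j) (s2 j)"
      unfolding act(2)[OF j] using bform_block_diag[OF Q s[OF j] s[OF j]]
      by (simp add: s1_def s2_def)
  qed
  have port: "(c @\<^sub>v w) \<bullet> y = c \<bullet> vec_first y m + w \<bullet> vec_last y e"
    if "c \<in> carrier_vec m" "w \<in> carrier_vec e" "y \<in> carrier_vec (m + e)" for c w y :: "real vec" and e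
    using scalar_prod_append[OF that(1,2) vec_first_carrier vec_last_carrier, of y y] that(3) by simp
  define yc where "yc = vec_first y1 m @\<^sub>v vec_first y2 m"
  have yc: "yc \<in> carrier_vec (m + m)"
    unfolding yc_def by (intro append_carrier_vec vec_first_carrier)
  have Cz: "mat_C L1 *\<^sub>v z1 \<in> carrier_vec (m + e1)" "mat_C L2 *\<^sub>v z2 \<in> carrier_vec (m + e2)"
    using C z by auto
  have "c1 \<bullet> vec_first y1 m + c2 \<bullet> vec_first y2 m = (c1 @\<^sub>v c2) \<bullet> yc"
    unfolding yc_def by (rule scalar_prod_append[OF c vec_first_carrier vec_first_carrier, symmetric])
  also have "c1 @\<^sub>v c2 = K *\<^sub>v yc"
    unfolding yc_def y1_def y2_def
    by (rule feedback_input_fixpoint[OF D K(1) X Cz v(1,2) c loop])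
  also have "(K *\<^sub>v yc) \<bullet> yc = bform K yc yc"
    unfolding bform_def by (rule comm_scalar_prod[OF mult_mat_vec_carrier[OF K(1) yc] yc])
  also have "\<dots> = 0"
    by (rule bform_skew[OF K yc])
  finally have lossless: "c1 \<bullet> vec_first y1 m + c2 \<bullet> vec_first y2 m = 0" .
  have ports: "v \<bullet> (vec_last y1 e1 @\<^sub>v vec_last y2 e2) = (c1 @\<^sub>v v1) \<bullet> y1 + (c2 @\<^sub>v v2) \<bullet> y2"
    unfolding v(3) scalar_prod_append[OF v(1,2) vec_last_carrier vec_last_carrier]
      port[OF c(1) v(1) y(1)] port[OF c(2) v(2) y(2)]
    using lossless by simp
  \<comment> \<open>The single dissipation inequalities are taken at the completed controls, so
    their supply rates still contain the connected ports; these cancel in the sum by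
    \<open>ports\<close>.\<close>
  have "z1 \<bullet> f1 + (1/2) * (\<Sum>j=1..k. bform Q1 (s1 j) (s1 j)) \<le> (c1 @\<^sub>v v1) \<bullet> y1"
    using diss(1)[unfolded dissipative_def, rule_format, OF z(1) cv(1)]
    by (simp add: f1_def s1_def y1_def)
  moreover have "z2 \<bullet> f2 + (1/2) * (\<Sum>j=1..k. bform Q2 (s2 j) (s2 j)) \<le> (c2 @\<^sub>v v2) \<bullet> y2"
    using diss(2)[unfolded dissipative_def, rule_format, OF z(2) cv(2)]
    by (simp add: f2_def s2_def y2_def)
  ultimately show "z \<bullet> (mat_A I *\<^sub>v z + mat_B I *\<^sub>v v)
        + (1/2) * (\<Sum>j=1..k. bform (block_diag Q1 Q2) (mat_AA I j *\<^sub>v z + mat_BB I j *\<^sub>v v)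
                                    (mat_AA I j *\<^sub>v z + mat_BB I j *\<^sub>v v))
        \<le> v \<bullet> (mat_C I *\<^sub>v z + mat_D I *\<^sub>v v)"
    unfolding act(1,3) state noise ports by (simp add: algebra_simps)
qed

text \<open>State outputs \<open>C x = C' (Q x)\<close> and feedthroughs agree in both descriptions,
  so the loop produces the same connected controls. After that the two sides agree system by
  system.\<close>

lemma interconnection_factors:
  assumes L: "system_carrier k d1 (m + e1) L1" "system_carrier k d2 (m + e2) L2"
    and L': "system_carrier k d1 (m + e1) L1'" "system_carrier k d2 (m + e2) L2'"
    and Q: "Q1 \<in> carrier_mat d1 d1" "Q2 \<in> carrier_mat d2 d2"
    and fac: "factors_through k Q1 L1 L1'" "factors_through k Q2 L2 L2'"
    and K: "K \<in> carrier_mat (m + m) (m + m)"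
    and X: "the (mat_inverse (coupling_mat m K L1' L2')) \<in> carrier_mat (m + m) (m + m)"
    and x: "x \<in> carrier_vec (d1 + d2)" and v: "v \<in> carrier_vec (e1 + e2)"
    and I: "I = interconnection_matrices m K L1 L2" and I': "I' = interconnection_matrices m K L1' L2'"
  shows "mat_A I *\<^sub>v x + mat_B I *\<^sub>v v = mat_A I' *\<^sub>v (block_diag Q1 Q2 *\<^sub>v x) + mat_B I' *\<^sub>v v"
    and "j \<in> {1..k} \<Longrightarrow> mat_AA I j *\<^sub>v x + mat_BB I j *\<^sub>v v
           = mat_AA I' j *\<^sub>v (block_diag Q1 Q2 *\<^sub>v x) + mat_BB I' j *\<^sub>v v"
    and "mat_C I *\<^sub>v x + mat_D I *\<^sub>v v = mat_C I' *\<^sub>v (block_diag Q1 Q2 *\<^sub>v x) + mat_D I' *\<^sub>v v"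
proof -
  obtain x1 x2 where x12: "x1 \<in> carrier_vec d1" "x2 \<in> carrier_vec d2" and x_eq: "x = x1 @\<^sub>v x2"
    using vec_split[OF x] .
  obtain v1 v2 where v12: "v1 \<in> carrier_vec e1" "v2 \<in> carrier_vec e2" and v_eq: "v = v1 @\<^sub>v v2"
    using vec_split[OF v] .
  have D': "mat_D L1' \<in> carrier_mat (m + e1) (m + e1)" "mat_D L2' \<in> carrier_mat (m + e2) (m + e2)"
    using L' by (auto simp: system_carrier_def)
  have Deq: "mat_D L1 = mat_D L1'" "mat_D L2 = mat_D L2'"
    using fac by (auto simp: factors_through_def)
  \<comment> \<open>The coupling involves the feedthrough alone, which carries no factor
    \<open>Q\<close>; hence both interconnections use the same inverse.\<close>
  have Mc: "coupling_mat m K L1 L2 = coupling_mat m K L1' L2'"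
    by (simp add: coupling_mat_def Deq)
  have z: "Q1 *\<^sub>v x1 \<in> carrier_vec d1" "Q2 *\<^sub>v x2 \<in> carrier_vec d2"
    using Q x12 by auto
  have Qx: "block_diag Q1 Q2 *\<^sub>v x = (Q1 *\<^sub>v x1) @\<^sub>v (Q2 *\<^sub>v x2)"
    unfolding x_eq by (rule block_diag_mult_vec[OF Q x12])
  have lin: "mat_A L1 *\<^sub>v x1 = mat_A L1' *\<^sub>v (Q1 *\<^sub>v x1)" "mat_A L2 *\<^sub>v x2 = mat_A L2' *\<^sub>v (Q2 *\<^sub>v x2)"
    "mat_C L1 *\<^sub>v x1 = mat_C L1' *\<^sub>v (Q1 *\<^sub>v x1)" "mat_C L2 *\<^sub>v x2 = mat_C L2' *\<^sub>v (Q2 *\<^sub>v x2)"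
    using fac L' Q x12 by (auto simp: factors_through_def system_carrier_def intro!: assoc_mult_mat_vec)
  have linj: "mat_AA L1 j *\<^sub>v x1 = mat_AA L1' j *\<^sub>v (Q1 *\<^sub>v x1)" "mat_AA L2 j *\<^sub>v x2 = mat_AA L2' j *\<^sub>v (Q2 *\<^sub>v x2)"
    "mat_BB L1 j = mat_BB L1' j" "mat_BB L2 j = mat_BB L2' j" if "j \<in> {1..k}"
    using fac L' Q x12 that by (auto simp: factors_through_def system_carrier_def intro!: assoc_mult_mat_vec)
  have Beq: "mat_B L1 = mat_B L1'" "mat_B L2 = mat_B L2'"
    using fac by (auto simp: factors_through_def)
  define w where "w = feedback_input m K L1' L2' (mat_C L1' *\<^sub>v (Q1 *\<^sub>v x1)) (mat_C L2' *\<^sub>v (Q2 *\<^sub>v x2)) v1 v2"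
  have "w \<in> carrier_vec (m + m)"
    unfolding w_def feedback_input_def
    by (intro mult_mat_vec_carrier[OF X] mult_mat_vec_carrier[OF K])
      (use blocks_carrier(2)[OF D'(1)] blocks_carrier(2)[OF D'(2)] v12 in auto)
  then obtain c1 c2 where c: "c1 \<in> carrier_vec m" "c2 \<in> carrier_vec m" and w: "w = c1 @\<^sub>v c2"
    by (rule vec_split)
  have loop': "c1 @\<^sub>v c2 = feedback_input m K L1' L2' (mat_C L1' *\<^sub>v (Q1 *\<^sub>v x1)) (mat_C L2' *\<^sub>v (Q2 *\<^sub>v x2)) v1 v2"
    using w w_def by simp
  have loop: "c1 @\<^sub>v c2 = feedback_input m K L1 L2 (mat_C L1 *\<^sub>v x1) (mat_C L2 *\<^sub>v x2) v1 v2"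
    unfolding loop' lin by (simp add: feedback_input_def Mc Deq)
  note act = interconnection_mult_vec[OF L K X[folded Mc] x12 v12 c loop I, folded x_eq v_eq]
    and act' = interconnection_mult_vec[OF L' K X z v12 c loop' I', folded Qx v_eq]
  show "mat_A I *\<^sub>v x + mat_B I *\<^sub>v v = mat_A I' *\<^sub>v (block_diag Q1 Q2 *\<^sub>v x) + mat_B I' *\<^sub>v v"
    unfolding act(1) act'(1) lin Beq ..
  show "mat_AA I j *\<^sub>v x + mat_BB I j *\<^sub>v v
           = mat_AA I' j *\<^sub>v (block_diag Q1 Q2 *\<^sub>v x) + mat_BB I' j *\<^sub>v v" if "j \<in> {1..k}"
    unfolding act(2)[OF that] act'(2)[OF that] linj[OF that] ..
  show "mat_C I *\<^sub>v x + mat_D I *\<^sub>v v = mat_C I' *\<^sub>v (block_diag Q1 Q2 *\<^sub>v x) + mat_D I' *\<^sub>v v"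
    unfolding act(3) act'(3) lin Deq ..
qed

theorem proposition9p12:
  fixes \<B> :: "'w stoch_basis"
    and \<Sigma>1 \<Sigma>2 :: "'w control_system"
    and L1 L2 :: system_matrices
    and m :: nat
    and K :: "real mat"
    and x0 :: "real vec"
  assumes "stochastic_basis \<B>"
    and "slti_phs_with_N \<B> \<Sigma>1 (0\<^sub>m (control_dim \<Sigma>1) (control_dim \<Sigma>1))"
    and "slti_phs_with_N \<B> \<Sigma>2 (0\<^sub>m (control_dim \<Sigma>2) (control_dim \<Sigma>2))"
    and "controls \<Sigma>1 = square_integrable_controls \<B> (control_dim \<Sigma>1)"
    and "controls \<Sigma>2 = square_integrable_controls \<B> (control_dim \<Sigma>2)"
    and "has_system_matrices (noise_dim \<B>) \<Sigma>1 L1"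
    and "has_system_matrices (noise_dim \<B>) \<Sigma>2 L2"
    and "m \<in> {1..min (control_dim \<Sigma>1) (control_dim \<Sigma>2)}"
    and "K \<in> carrier_mat (2 * m) (2 * m)"
    and "K = - K\<^sup>T"
    and "x0 \<in> carrier_vec (state_dim \<Sigma>1 + state_dim \<Sigma>2)"
  shows "invertible_mat (coupling_mat m K L1 L2) \<and>
         slti_phs \<B> (interconnected_system \<B> m K L1 L2 x0)"
proof -
  define k d1 d2 e1 e2 where "k = noise_dim \<B>" and "d1 = state_dim \<Sigma>1" and "d2 = state_dim \<Sigma>2"
    and "e1 = control_dim \<Sigma>1 - m" and "e2 = control_dim \<Sigma>2 - m"
  have n: "control_dim \<Sigma>1 = m + e1" "control_dim \<Sigma>2 = m + e2"
    using assms(8) by (auto simp: e1_def e2_def)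
  have K: "K \<in> carrier_mat (m + m) (m + m)" "K = - K\<^sup>T"
    using assms(9,10) by (simp_all only: mult_2)
  have L: "system_carrier k d1 (m + e1) L1" "system_carrier k d2 (m + e2) L2"
    using assms(6,7) unfolding system_carrier_def has_system_matrices_def Let_def n k_def d1_def d2_def
    by blast+
  obtain J1 R1 Q1 AA1 F1 P1 BB1 S1 where
    "has_phs_form k \<Sigma>1 J1 R1 Q1 AA1 F1 P1 BB1 S1 (0\<^sub>m (control_dim \<Sigma>1) (control_dim \<Sigma>1))"
    using assms(2) unfolding slti_phs_with_N_def k_def by blast
  note phs1 = this
  obtain J2 R2 Q2 AA2 F2 P2 BB2 S2 where
    "has_phs_form k \<Sigma>2 J2 R2 Q2 AA2 F2 P2 BB2 S2 (0\<^sub>m (control_dim \<Sigma>2) (control_dim \<Sigma>2))"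
    using assms(3) unfolding slti_phs_with_N_def k_def by blast
  note phs2 = this
  have Q: "psd_mat d1 Q1" "psd_mat d2 Q2"
    using phs1 phs2 unfolding has_phs_form_def Let_def d1_def d2_def by blast+
  then have Qc: "Q1 \<in> carrier_mat d1 d1" "Q2 \<in> carrier_mat d2 d2"
    by (simp_all add: psd_mat_def)
  obtain L1' where L1': "system_carrier k d1 (m + e1) L1'" "dissipative k d1 (m + e1) Q1 L1'"
    "factors_through k Q1 L1 L1'" "(mat_D L1')\<^sup>T = mat_D L1'"
    using phs_form_imp_dissipative[OF phs1 assms(6)[folded k_def]] unfolding n d1_def[symmetric] .
  obtain L2' where L2': "system_carrier k d2 (m + e2) L2'" "dissipative k d2 (m + e2) Q2 L2'"
    "factors_through k Q2 L2 L2'" "(mat_D L2')\<^sup>T = mat_D L2'"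
    using phs_form_imp_dissipative[OF phs2 assms(7)[folded k_def]] unfolding n d2_def[symmetric] .
  have Mc: "coupling_mat m K L1 L2 = coupling_mat m K L1' L2'"
    using L1'(3) L2'(3) by (simp add: coupling_mat_def factors_through_def)
  \<comment> \<open>Symmetry of both feedthroughs, and thereby \<open>N(i) = 0\<close>, is used
    here.\<close>
  have psd: "psd_mat (m + m) (block_diag (block_ul m m (mat_D L1')) (block_ul m m (mat_D L2')))"
    using psd_mat_block_ul_feedthrough[OF L1'(1) Q(1) L1'(2,4)]
      psd_mat_block_ul_feedthrough[OF L2'(1) Q(2) L2'(2,4)]
    by (rule psd_mat_block_diag)
  obtain X where X: "mat_inverse (coupling_mat m K L1' L2') = Some X" "X \<in> carrier_mat (m + m) (m + m)"
    "coupling_mat m K L1' L2' * X = 1\<^sub>m (m + m)" "X * coupling_mat m K L1' L2' = 1\<^sub>m (m + m)"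
    by (rule skew_psd_coupling_invertible[OF K psd, folded coupling_mat_altdef])
  have Xc: "the (mat_inverse (coupling_mat m K L1' L2')) \<in> carrier_mat (m + m) (m + m)"
    "the (mat_inverse (coupling_mat m K L1 L2)) \<in> carrier_mat (m + m) (m + m)"
    using X Mc by simp_all
  \<comment> \<open>The right inverse fixes the number of rows, the left inverse the number of
    columns.\<close>
  have "coupling_mat m K L1' L2' \<in> carrier_mat (m + m) (m + m)"
    using arg_cong[OF X(3), of dim_row] arg_cong[OF X(4), of dim_col] by auto
  then have inv: "invertible_mat (coupling_mat m K L1 L2)"
    using X unfolding Mc invertible_mat_def inverts_mat_def by (auto simp: square_mat.simps)

  \<comment> \<open>\<open>I\<close> belongs to the actual system; \<open>I'\<close> is its co-state
    version, from which the port-Hamiltonian matrices are read off.\<close>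
  define I I' where "I = interconnection_matrices m K L1 L2" and "I' = interconnection_matrices m K L1' L2'"
  define \<Sigma> where "\<Sigma> = interconnected_system \<B> m K L1 L2 x0"
  have dims: "dim_row (mat_A L1) = d1" "dim_row (mat_A L2) = d2"
    "dim_col (mat_B L1) = m + e1" "dim_col (mat_B L2) = m + e2"
    using L by (auto simp: system_carrier_def)
  have \<Sigma>: "state_dim \<Sigma> = d1 + d2" "control_dim \<Sigma> = e1 + e2"
    "drift \<Sigma> = (\<lambda>x v. mat_A I *\<^sub>v x + mat_B I *\<^sub>v v)"
    "diffusion \<Sigma> = (\<lambda>j x v. mat_AA I j *\<^sub>v x + mat_BB I j *\<^sub>v v)"
    "readout \<Sigma> = (\<lambda>x v. mat_C I *\<^sub>v x + mat_D I *\<^sub>v v)"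
    "init \<Sigma> = x0" "controls \<Sigma> = square_integrable_controls \<B> (e1 + e2)"
    by (simp_all add: \<Sigma>_def interconnected_system_def Let_def dims I_def)
  have Ic: "system_carrier k (d1 + d2) (e1 + e2) I"
    unfolding I_def by (rule interconnection_carrier[OF L K(1) Xc(2)])
  have Ic': "system_carrier k (d1 + d2) (e1 + e2) I'"
    unfolding I'_def by (rule interconnection_carrier[OF L1'(1) L2'(1) K(1) Xc(1)])
  have "0 < d1"
    using assms(2) unfolding slti_phs_with_N_def wf_control_system_def Let_def d1_def by blast
  then have wf: "wf_control_system \<B> \<Sigma>"
    unfolding wf_control_system_def Let_def \<Sigma>
    using Ic assms(11)
    by (auto simp: square_integrable_controls_def system_carrier_def k_def d1_def d2_def
        intro!: add_carrier_vec mult_mat_vec_carrier)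
  have "\<exists>J R F P S N. has_phs_form k \<Sigma> J R (block_diag Q1 Q2) (mat_AA I') F P (mat_BB I') S N"
  proof (rule has_phs_form_if_dissipative)
    show "system_carrier k (state_dim \<Sigma>) (control_dim \<Sigma>) I'"
      unfolding \<Sigma> by (rule Ic')
    show "psd_mat (state_dim \<Sigma>) (block_diag Q1 Q2)"
      unfolding \<Sigma> by (rule psd_mat_block_diag[OF Q])
    show "dissipative k (state_dim \<Sigma>) (control_dim \<Sigma>) (block_diag Q1 Q2) I'"
      unfolding \<Sigma> I'_def
      by (rule interconnection_dissipative[OF L1'(1) L2'(1) Qc L1'(2) L2'(2) K X(1-3)])
  next
    fix x v :: "real vec" assume "x \<in> carrier_vec (state_dim \<Sigma>)" "v \<in> carrier_vec (control_dim \<Sigma>)"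
    note xv = this[unfolded \<Sigma>]
    note fac = interconnection_factors[OF L L1'(1) L2'(1) Qc L1'(3) L2'(3) K(1) Xc(1) xv I_def I'_def]
    show "drift \<Sigma> x v = mat_A I' *\<^sub>v (block_diag Q1 Q2 *\<^sub>v x) + mat_B I' *\<^sub>v v \<and>
      (\<forall>j\<in>{1..k}. diffusion \<Sigma> j x v = mat_AA I' j *\<^sub>v (block_diag Q1 Q2 *\<^sub>v x) + mat_BB I' j *\<^sub>v v) \<and>
      readout \<Sigma> x v = mat_C I' *\<^sub>v (block_diag Q1 Q2 *\<^sub>v x) + mat_D I' *\<^sub>v v"
      unfolding \<Sigma> using fac by blast
  qed
  \<comment> \<open>The skew part of the new feedthrough supplies \<open>N\<close>, which
    \<open>slti_phs\<close> leaves free.\<close>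
  with wf have "slti_phs \<B> \<Sigma>"
    unfolding slti_phs_def slti_phs_with_N_def k_def by blast
  then show ?thesis
    using inv by (simp add: \<Sigma>_def)
qed

end
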